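(* Let $G=(V,D,B)$ be a mixed graph. (a) If there are a family $(Y_v:v\in V)$ with each $Y_v$ satisfying the weak half-trek criterion with respect to $v$ and a total ordering $\prec$ on $V$ with $w\prec v$ whenever $w\in Y_v\cap\mathrm{htr}(v)$, then $G$ is rationally identifiable; moreover such a family and ordering exist if and only if $G$ is HTC-identifiable. (b) If every family $(Y_v:v\in V)$ of subsets of $V$ either contains a $Y_v$ not satisfying the weak half-trek criterion with respect to $v$ or contains a pair $Y_v,Y_w$ with $v\in Y_w$ and $w\in Y_v$, then $\phi_G$ is generically infinite-to-one; moreover this condition holds if and only if $G$ is HTC-infinite-to-one.
   Context: A mixed graph is $G=(V,D,B)$ with $V=[m]$, $D\subseteq V\times V$ directed edges $v\to w$, $B$ symmetric set of bidirected edges $v\leftrightarrow w$, no self-loops. $\mathrm{pa}(v)=\{w:w\to v\in D\}$, $\mathrm{sib}(v)=\{w:w\leftrightarrow v\in B\}$. $\mathbb{R}^D_{\mathrm{reg}}$: real $m\times m$ $\Lambda$ with $\lambda_{vw}=0$ for $v\to w\notin D$ and $I-\Lambda$ invertible; $\mathrm{PD}(B)$: positive definite symmetric $\Omega$ with $\omega_{vw}=0$ for $v\ne w$, $v\leftrightarrow w\notin B$; $\Theta=\mathbb{R}^D_{\mathrm{reg}}\times\mathrm{PD}(B)$; $\phi_G(\Lambda,\Omega)=(I-\Lambda)^{-T}\Omega(I-\Lambda)^{-1}$. A proper algebraic subset of $\Theta$ is the zero set in $\Theta$ of polynomials in the entries, not all of $\Theta$. $G$ is rationally identifiable if there exist a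 proper algebraic subset $W$ and a rational map $\psi$ with $\psi\circ\phi_G=\mathrm{id}$ on $\Theta\setminus W$. $\phi_G$ is generically infinite-to-one if its fibers $\{(\Lambda',\Omega')\in\Theta:\phi_G(\Lambda',\Omega')=\phi_G(\Lambda,\Omega)\}$ are infinite for all $(\Lambda,\Omega)$ outside a proper algebraic subset. A path is a sequence of edges of $D\cup B$ connecting consecutive nodes (not necessarily simple; directed edges traversable either way). A trek from $v$ to $w$ is a path $v=v^L_l\leftarrow\cdots\leftarrow v^L_0\leftrightarrow v^R_0\to\cdots\to v^R_r=w$ with $\mathrm{Left}=\{v^L_0,\dots,v^L_l\}$, $\mathrm{Right}=\{v^R_0,\dots,v^R_r\}$, or $v=v^L_l\leftarrow\cdots\leftarrow v^L_1\leftarrow v^T\to v^R_1\to\cdots\to v^R_r=w$ ($l,r\ge0$) with $\mathrm{Left}=\{v^T,v^L_1,\dots\}$, $\mathrm{Right}=\{v^T,v^R_1,\dots\}$. A half-trek is a trek with $|\mathrm{Left}|=1$. A system of treks from $X$ to $Y$: treks with distinct sources forming $X$ and distinct targets forming $Y$; no sided intersection: Left sets pairwise disjoint and Right sets pairwise disjoint. $\mathrm{htr}(v)$: set of $w\in V\setminus(\{v\}\cup\mathrm{sib}(v))$ reachable from $v$ by a half-trek. $Y$ satisfies the half-trek criterion w.r.t. $v$ if (i) $|Y|=|\mathrm{pa}(v)|$, (ii) $Y\cap(\{v\}\cup\mathrm{sib}(v))=\emptyset$, (iii) there is a system of half-treks with no sided intersection from $Y$ to $\mathrm{pa}(v)$;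 it satisfies the weak half-trek criterion if (i), (ii) hold and there is a system of treks with no sided intersection from $Y$ to $\mathrm{pa}(v)$ in which the trek from each $w\in Y\cap\mathrm{htr}(v)$ is a half-trek. $G$ is HTC-identifiable if there exist a family $(Y_v)$, each satisfying the half-trek criterion w.r.t. $v$, and a total order $\prec$ with $w\prec v$ whenever $w\in Y_v\cap\mathrm{htr}(v)$. $G$ is HTC-infinite-to-one if every family $(Y_v:v\in V)$ either contains some $Y_v$ failing the half-trek criterion w.r.t. $v$ or contains a pair with $v\in Y_w$, $w\in Y_v$. *)

theory Defs
  imports "HOL-Analysis.Analysis"
begin

text \<open>Vertices are the elements of a finite type 'n (playing the role of V = [m]).
  D: directed edges (v,w) meaning v -> w.  B: bidirected edges (symmetric).\<close>

definition mixed_graph :: "('n::finite \<times> 'n) set \<Rightarrow> ('n \<times> 'n) set \<Rightarrow> bool" where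
  "mixed_graph D B \<longleftrightarrow> irrefl D \<and> irrefl B \<and> sym B"

definition pa :: "('n \<times> 'n) set \<Rightarrow> 'n \<Rightarrow> 'n set" where
  "pa D v = {w. (w, v) \<in> D}"

definition sib :: "('n \<times> 'n) set \<Rightarrow> 'n \<Rightarrow> 'n set" where
  "sib B v = {w. (w, v) \<in> B}"

definition RDreg :: "('n::finite \<times> 'n) set \<Rightarrow> (real^'n^'n) set" where
  "RDreg D = {\<Lambda>. (\<forall>v w. (v, w) \<notin> D \<longrightarrow> \<Lambda> $ v $ w = 0) \<and> invertible (mat 1 - \<Lambda>)}"

definition PD :: "('n::finite \<times> 'n) set \<Rightarrow> (real^'n^'n) set" where
  "PD B = {\<Omega>. transpose \<Omega> = \<Omega> \<and>
              (\<forall>v w. v \<noteq> w \<and> (v, w) \<notin> B \<longrightarrow> \<Omega> $ v $ w = 0) \<and>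
              (\<forall>x. x \<noteq> 0 \<longrightarrow> x \<bullet> (\<Omega> *v x) > 0)}"

definition Theta :: "('n::finite \<times> 'n) set \<Rightarrow> ('n \<times> 'n) set \<Rightarrow> ((real^'n^'n) \<times> (real^'n^'n)) set" where
  "Theta D B = RDreg D \<times> PD B"

definition phi :: "(real^'n::finite^'n) \<times> (real^'n^'n) \<Rightarrow> real^'n^'n" where
  "phi \<theta> = (case \<theta> of (\<Lambda>, \<Omega>) \<Rightarrow>
     transpose (matrix_inv (mat 1 - \<Lambda>)) ** \<Omega> ** matrix_inv (mat 1 - \<Lambda>))"

inductive polyfun :: "(('i \<Rightarrow> real) \<Rightarrow> real) \<Rightarrow> bool" where
  pf_const: "polyfun (\<lambda>x. c)"
| pf_var: "polyfun (\<lambda>x. x i)"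
| pf_add: "polyfun p \<Longrightarrow> polyfun q \<Longrightarrow> polyfun (\<lambda>x. p x + q x)"
| pf_mult: "polyfun p \<Longrightarrow> polyfun q \<Longrightarrow> polyfun (\<lambda>x. p x * q x)"

definition theta_coords :: "(real^'n::finite^'n) \<times> (real^'n^'n) \<Rightarrow> ('n \<times> 'n) + ('n \<times> 'n) \<Rightarrow> real" where
  "theta_coords \<theta> k = (case k of Inl (i, j) \<Rightarrow> fst \<theta> $ i $ j | Inr (i, j) \<Rightarrow> snd \<theta> $ i $ j)"

definition mat_coords :: "real^'n::finite^'n \<Rightarrow> 'n \<times> 'n \<Rightarrow> real" where
  "mat_coords S k = S $ fst k $ snd k"

definition proper_algebraic_subset ::
  "('n::finite \<times> 'n) set \<Rightarrow> ('n \<times> 'n) set \<Rightarrow> ((real^'n^'n) \<times> (real^'n^'n)) set \<Rightarrow> bool" where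
  "proper_algebraic_subset D B W \<longleftrightarrow>
     (\<exists>F. (\<forall>f\<in>F. polyfun f) \<and>
          W = {\<theta> \<in> Theta D B. \<forall>f\<in>F. f (theta_coords \<theta>) = 0}) \<and> W \<noteq> Theta D B"

definition rationally_identifiable :: "('n::finite \<times> 'n) set \<Rightarrow> ('n \<times> 'n) set \<Rightarrow> bool" where
  "rationally_identifiable D B \<longleftrightarrow>
     (\<exists>W p q. proper_algebraic_subset D B W \<and>
        (\<forall>k. polyfun (p k) \<and> polyfun (q k)) \<and>
        (\<forall>\<theta> \<in> Theta D B - W. \<forall>k.
            q k (mat_coords (phi \<theta>)) \<noteq> 0 \<and>
            p k (mat_coords (phi \<theta>)) / q k (mat_coords (phi \<theta>)) = theta_coords \<theta> k))"

definition fiber :: "('n::finite \<times> 'n) set \<Rightarrow> ('n \<times> 'n) set \<Rightarrow> (real^'n^'n) \<times> (real^'n^'n)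
                      \<Rightarrow> ((real^'n^'n) \<times> (real^'n^'n)) set" where
  "fiber D B \<theta> = {\<theta>' \<in> Theta D B. phi \<theta>' = phi \<theta>}"

definition generically_infinite_to_one :: "('n::finite \<times> 'n) set \<Rightarrow> ('n \<times> 'n) set \<Rightarrow> bool" where
  "generically_infinite_to_one D B \<longleftrightarrow>
     (\<exists>W. proper_algebraic_subset D B W \<and> (\<forall>\<theta> \<in> Theta D B - W. infinite (fiber D B \<theta>)))"

text \<open>A trek is a pair (L, R) of nonempty vertex lists.  L = [v^L_0, ..., v^L_l] (resp.
  [v^T, v^L_1, ..., v^L_l]) with directed edges between consecutive entries, and source
  last L; similarly R with target last R.  Either hd L = hd R (the top node v^T) or
  hd L <-> hd R is a bidirected edge.  Left = set L, Right = set R.\<close>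

type_synonym 'n trek = "'n list \<times> 'n list"

definition directed_chain :: "('n \<times> 'n) set \<Rightarrow> 'n list \<Rightarrow> bool" where
  "directed_chain D xs \<longleftrightarrow> xs \<noteq> [] \<and> (\<forall>i. Suc i < length xs \<longrightarrow> (xs ! i, xs ! Suc i) \<in> D)"

definition is_trek :: "('n \<times> 'n) set \<Rightarrow> ('n \<times> 'n) set \<Rightarrow> 'n trek \<Rightarrow> bool" where
  "is_trek D B t \<longleftrightarrow> directed_chain D (fst t) \<and> directed_chain D (snd t) \<and>
     (hd (fst t) = hd (snd t) \<or> (hd (fst t), hd (snd t)) \<in> B)"

definition trek_src :: "'n trek \<Rightarrow> 'n" where "trek_src t = last (fst t)"
definition trek_tgt :: "'n trek \<Rightarrow> 'n" where "trek_tgt t = last (snd t)"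
definition trek_Left :: "'n trek \<Rightarrow> 'n set" where "trek_Left t = set (fst t)"
definition trek_Right :: "'n trek \<Rightarrow> 'n set" where "trek_Right t = set (snd t)"

definition is_half_trek :: "('n \<times> 'n) set \<Rightarrow> ('n \<times> 'n) set \<Rightarrow> 'n trek \<Rightarrow> bool" where
  "is_half_trek D B t \<longleftrightarrow> is_trek D B t \<and> card (trek_Left t) = 1"

definition htr :: "('n::finite \<times> 'n) set \<Rightarrow> ('n \<times> 'n) set \<Rightarrow> 'n \<Rightarrow> 'n set" where
  "htr D B v = {w. w \<notin> {v} \<union> sib B v \<and>
                   (\<exists>t. is_half_trek D B t \<and> trek_src t = v \<and> trek_tgt t = w)}"

definition trek_system_nsi :: "('n \<times> 'n) set \<Rightarrow> ('n \<times> 'n) set \<Rightarrow> 'n set \<Rightarrow> 'n set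
                                \<Rightarrow> ('n \<Rightarrow> 'n trek) \<Rightarrow> bool" where
  "trek_system_nsi D B X Y \<tau> \<longleftrightarrow>
     (\<forall>x\<in>X. is_trek D B (\<tau> x) \<and> trek_src (\<tau> x) = x) \<and>
     bij_betw (trek_tgt \<circ> \<tau>) X Y \<and>
     (\<forall>x\<in>X. \<forall>y\<in>X. x \<noteq> y \<longrightarrow>
        trek_Left (\<tau> x) \<inter> trek_Left (\<tau> y) = {} \<and> trek_Right (\<tau> x) \<inter> trek_Right (\<tau> y) = {})"

definition HTC :: "('n::finite \<times> 'n) set \<Rightarrow> ('n \<times> 'n) set \<Rightarrow> 'n set \<Rightarrow> 'n \<Rightarrow> bool" where
  "HTC D B Y v \<longleftrightarrow> card Y = card (pa D v) \<and> Y \<inter> ({v} \<union> sib B v) = {} \<and>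
     (\<exists>\<tau>. trek_system_nsi D B Y (pa D v) \<tau> \<and> (\<forall>y\<in>Y. is_half_trek D B (\<tau> y)))"

definition weak_HTC :: "('n::finite \<times> 'n) set \<Rightarrow> ('n \<times> 'n) set \<Rightarrow> 'n set \<Rightarrow> 'n \<Rightarrow> bool" where
  "weak_HTC D B Y v \<longleftrightarrow> card Y = card (pa D v) \<and> Y \<inter> ({v} \<union> sib B v) = {} \<and>
     (\<exists>\<tau>. trek_system_nsi D B Y (pa D v) \<tau> \<and> (\<forall>y \<in> Y \<inter> htr D B v. is_half_trek D B (\<tau> y)))"

definition HTC_identifiable :: "('n::finite \<times> 'n) set \<Rightarrow> ('n \<times> 'n) set \<Rightarrow> bool" where
  "HTC_identifiable D B \<longleftrightarrow>
     (\<exists>Y r. (\<forall>v. HTC D B (Y v) v) \<and> strict_linear_order r \<and>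
            (\<forall>v w. w \<in> Y v \<inter> htr D B v \<longrightarrow> (w, v) \<in> r))"

definition HTC_infinite_to_one :: "('n::finite \<times> 'n) set \<Rightarrow> ('n \<times> 'n) set \<Rightarrow> bool" where
  "HTC_infinite_to_one D B \<longleftrightarrow>
     (\<forall>Y :: 'n \<Rightarrow> 'n set. (\<exists>v. \<not> HTC D B (Y v) v) \<or> (\<exists>v w. v \<noteq> w \<and> v \<in> Y w \<and> w \<in> Y v))"

end

theory Submission
  imports Defs "HOL-Computational_Algebra.Polynomial"
begin

text \<open>Weak and ordinary criteria: a trek that is not a half-trek may be cut down to the half-trek
  starting at the head of its left side, and this does not change the sets Y_v Int htr(v). Members
  of mutual pairs are always half-trek reachable from one another, so mutual pairs survive as well.

  Identifiability: the column of Lambda indexed by v solves a linear system with one equation per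
  node of Y_v, whose coefficients are rational in Sigma and in the columns of smaller nodes. For
  Omega = C C^T its determinant is a product of two factors; each is nonzero for a suitable choice
  of parameters (edges of the half-trek system, shortened to disjoint simple paths), hence both are
  nonzero for one choice.

  Infinite fibres: if the Jacobian of phi were injective somewhere, then a system of linear
  equations enlarged by auxiliary unknowns (I - Lambda)^(-1) Delta, whose matrix has only entries of
  I - Lambda and of Omega, would have independent columns. A matching between its columns and rows
  along nonzero entries can be read as half-trek systems for sets Y_v without mutual pairs. So phi
  has a nontrivial kernel everywhere, and by the constant rank theorem its fibres contain curves
  wherever its rank is maximal.\<close>

subsection \<open>Weak and strong half-trek criterion\<close>

text \<open>Two kinds of equation feed the system at v. Omega vanishes at (y, v) when y is neither v
  nor a sibling of v, but this equation contains column y of Lambda; hence the ordering. If y is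
  moreover not half-trek reachable from v, then already Sigma (I - Lambda) vanishes at (y, v), and
  column y does not enter.

  A kernel vector Delta of the Jacobian satisfies equations with coefficients from Omega (I -
  Lambda)^(-1). A nonzero entry there only says that some half-trek exists, and nothing keeps the
  half-treks of different unknowns disjoint. After the enlargement a nonzero entry is a single edge
  or a diagonal entry, so injectivity of the matching yields disjointness. The rows for Omega are
  indexed by unordered pairs, each matched at most once: this excludes mutual pairs.

  Positive definiteness and maximal rank are not polynomial equations. The former is recovered by
  moving along a line towards (0, I). The latter is tested by the determinant of L^T J + pi, where J
  is the Jacobian at the point in question, L one of maximal rank, and pi the orthogonal projection
  onto the kernel of L.\<close>

lemma directed_chain_singleton [simp]: "directed_chain D [x]"
  by (simp add: directed_chain_def)

lemma directed_chain_Cons: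
  "directed_chain D (x # xs) \<longleftrightarrow> xs = [] \<or> (x, hd xs) \<in> D \<and> directed_chain D xs"
proof (cases xs)
  case (Cons y ys)
  have "(\<forall>i. Suc i < length (x # xs) \<longrightarrow> ((x # xs) ! i, (x # xs) ! Suc i) \<in> D) \<longleftrightarrow>
        (x, hd xs) \<in> D \<and> (\<forall>i. Suc i < length xs \<longrightarrow> (xs ! i, xs ! Suc i) \<in> D)" (is "?l = ?r")
  proof
    assume l: ?l
    have "(x, hd xs) \<in> D" using l[rule_format, of 0] Cons by simp
    moreover have "(xs ! i, xs ! Suc i) \<in> D" if "Suc i < length xs" for i
      using l[rule_format, of "Suc i"] that by simp
    ultimately show ?r by blast
  next
    assume r: ?r
    show ?l
    proof (intro allI impI)
      fix i assume "Suc i < length (x # xs)"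
      then show "((x # xs) ! i, (x # xs) ! Suc i) \<in> D" using r Cons by (cases i) auto
    qed
  qed
  then show ?thesis using Cons by (simp add: directed_chain_def)
qed simp

lemma directed_chain_append:
  assumes "xs \<noteq> []" "ys \<noteq> []"
  shows "directed_chain D (xs @ ys) \<longleftrightarrow>
    directed_chain D xs \<and> (last xs, hd ys) \<in> D \<and> directed_chain D ys"
  using assms(1)
proof (induction xs)
  case (Cons x xs)
  then show ?case using assms(2) by (cases "xs = []") (auto simp: directed_chain_Cons hd_append)
qed simp

lemma rtrancl_imp_directed_chain:
  assumes "(x, y) \<in> D\<^sup>*"
  shows "\<exists>xs. directed_chain D xs \<and> hd xs = x \<and> last xs = y"
  using assms
proof (induction rule: converse_rtrancl_induct)
  case base
  then show ?case by (intro exI[of _ "[y]"]) simp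
next
  case (step x z)
  then obtain xs where "directed_chain D xs" "hd xs = z" "last xs = y" by blast
  moreover from this have "xs \<noteq> []" by (simp add: directed_chain_def)
  ultimately show ?case using step(1)
    by (intro exI[of _ "x # xs"]) (auto simp: directed_chain_Cons)
qed

text \<open>Loop erasure: if the new head already occurs in the shortened tail, the tail is kept
  only from that occurrence on. Simple paths are needed later so that every node has one
  successor.\<close>

lemma directed_chain_distinct:
  assumes "directed_chain D xs"
  shows "\<exists>ys. directed_chain D ys \<and> distinct ys \<and> hd ys = hd xs \<and> last ys = last xs \<and> set ys \<subseteq> set xs"
  using assms
proof (induction xs)
  case (Cons x xs)
  show ?case
  proof (cases "xs = []")
    case True
    then show ?thesis by (intro exI[of _ "[x]"]) simp
  next
    case False
    with Cons obtain ys where ys: "directed_chain D ys" "distinct ys" "hd ys = hd xs"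
      "last ys = last xs" "set ys \<subseteq> set xs" and e: "(x, hd xs) \<in> D"
      by (auto simp: directed_chain_Cons)
    have ne: "ys \<noteq> []" using ys(1) by (simp add: directed_chain_def)
    show ?thesis
    proof (cases "x \<in> set ys")
      case True
      then obtain us vs where uv: "ys = us @ x # vs" by (meson split_list)
      have "directed_chain D (x # vs)"
        using ys(1) uv by (cases "us = []") (auto simp: directed_chain_append)
      then show ?thesis using ys uv False by (intro exI[of _ "x # vs"]) auto
    next
      case False
      then show ?thesis using ys e ne \<open>xs \<noteq> []\<close>
        by (intro exI[of _ "x # ys"]) (auto simp: directed_chain_Cons)
    qed
  qed
qed (simp add: directed_chain_def)

lemma half_trek_Left:
  assumes "is_half_trek D B t"
  shows "trek_Left t = {trek_src t}" "hd (fst t) = trek_src t"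
proof -
  have "fst t \<noteq> []" using assms by (simp add: is_half_trek_def is_trek_def directed_chain_def)
  then have "trek_src t \<in> trek_Left t" "hd (fst t) \<in> trek_Left t"
    by (auto simp: trek_src_def trek_Left_def)
  then show "trek_Left t = {trek_src t}" "hd (fst t) = trek_src t"
    using assms by (auto simp: is_half_trek_def card_1_singleton_iff)
qed

lemma half_trek_singleton [simp]:
  "is_half_trek D B ([x], xs) \<longleftrightarrow> directed_chain D xs \<and> (x = hd xs \<or> (x, hd xs) \<in> B)"
  by (auto simp: is_half_trek_def is_trek_def trek_Left_def)

text \<open>The cardinality in \<open>is_half_trek\<close> bounds the set of entries, not the length
  of the list. Rewriting the left side as a one-element list leaves a half-trek determined by its
  source and one directed path.\<close>

lemma half_trek_singletonI:
  assumes "is_half_trek D B t"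
  shows "is_half_trek D B ([trek_src t], snd t)"
  using assms half_trek_Left(2)[OF assms] by (auto simp: is_half_trek_def is_trek_def trek_Left_def)

lemma mem_htr_iff:
  "w \<in> htr D B v \<longleftrightarrow> w \<notin> {v} \<union> sib B v \<and>
     (\<exists>xs. directed_chain D xs \<and> (v = hd xs \<or> (v, hd xs) \<in> B) \<and> last xs = w)"
proof -
  have "(\<exists>t. is_half_trek D B t \<and> trek_src t = v \<and> trek_tgt t = w) \<longleftrightarrow>
     (\<exists>xs. directed_chain D xs \<and> (v = hd xs \<or> (v, hd xs) \<in> B) \<and> last xs = w)"
  proof
    assume "\<exists>t. is_half_trek D B t \<and> trek_src t = v \<and> trek_tgt t = w"
    then obtain t where t: "is_half_trek D B t" "trek_src t = v" "trek_tgt t = w" by blast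
    show "\<exists>xs. directed_chain D xs \<and> (v = hd xs \<or> (v, hd xs) \<in> B) \<and> last xs = w"
      using half_trek_singletonI[OF t(1)] t(2,3) by (auto simp: trek_tgt_def)
  next
    assume "\<exists>xs. directed_chain D xs \<and> (v = hd xs \<or> (v, hd xs) \<in> B) \<and> last xs = w"
    then obtain xs where "directed_chain D xs" "v = hd xs \<or> (v, hd xs) \<in> B" "last xs = w" by blast
    then show "\<exists>t. is_half_trek D B t \<and> trek_src t = v \<and> trek_tgt t = w"
      by (intro exI[of _ "([v], xs)"]) (auto simp: trek_tgt_def trek_src_def)
  qed
  then show ?thesis by (simp add: htr_def)
qed

text \<open>Appending the final edge of the path into a parent of v shows that v itself is reached.\<close>
lemma HTC_mem_imp_htr:
  assumes "sym B" "HTC D B Y v" "y \<in> Y"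
  shows "v \<in> htr D B y"
proof -
  obtain \<tau> where sys: "trek_system_nsi D B Y (pa D v) \<tau>" and ht: "\<forall>y\<in>Y. is_half_trek D B (\<tau> y)"
    and dis: "Y \<inter> ({v} \<union> sib B v) = {}"
    using assms(2) by (auto simp: HTC_def)
  have src: "trek_src (\<tau> y) = y" and tgt: "trek_tgt (\<tau> y) \<in> pa D v"
    using sys assms(3) by (auto simp: trek_system_nsi_def bij_betw_def)
  have h: "is_half_trek D B ([y], snd (\<tau> y))"
    using half_trek_singletonI[of D B "\<tau> y"] ht assms(3) src by auto
  let ?xs = "snd (\<tau> y) @ [v]"
  have ne: "snd (\<tau> y) \<noteq> []" using h by (simp add: directed_chain_def)
  have "directed_chain D ?xs"
    using h ne tgt by (auto simp: directed_chain_append trek_tgt_def pa_def)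
  moreover have "y = hd ?xs \<or> (y, hd ?xs) \<in> B" using h ne by auto
  moreover have "v \<notin> {y} \<union> sib B y"
    using dis assms(1,3) by (auto simp: sib_def sym_def)
  ultimately show ?thesis unfolding mem_htr_iff by (intro conjI exI[of _ ?xs]) auto
qed

lemma HTC_imp_weak_HTC: "HTC D B Y v \<Longrightarrow> weak_HTC D B Y v"
  by (auto simp: HTC_def weak_HTC_def)

text \<open>A trek that is not a half-trek is replaced by the half-trek starting at the head of its
  left side; that head is not half-trek reachable from v, since otherwise its source would be.\<close>
lemma weak_HTC_imp_HTC:
  assumes "sym B" "weak_HTC D B Y v"
  shows "\<exists>Y'. HTC D B Y' v \<and> Y' \<inter> htr D B v = Y \<inter> htr D B v"
proof -
  obtain \<tau> where sys: "trek_system_nsi D B Y (pa D v) \<tau>"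
    and ht: "\<And>y. y \<in> Y \<inter> htr D B v \<Longrightarrow> is_half_trek D B (\<tau> y)"
    and dis: "Y \<inter> ({v} \<union> sib B v) = {}" and card: "card Y = card (pa D v)"
    using assms(2) by (auto simp: weak_HTC_def)
  have tr: "is_trek D B (\<tau> y)" "trek_src (\<tau> y) = y" if "y \<in> Y" for y
    using sys that by (auto simp: trek_system_nsi_def)
  define h where "h y = hd (fst (\<tau> y))" for y
  have ne: "fst (\<tau> y) \<noteq> []" "snd (\<tau> y) \<noteq> []" if "y \<in> Y" for y
    using tr(1)[OF that] by (auto simp: is_trek_def directed_chain_def)
  have hL: "h y \<in> trek_Left (\<tau> y)" if "y \<in> Y" for y
    using ne[OF that] by (simp add: h_def trek_Left_def)
  have inj: "inj_on h Y"
  proof (rule inj_onI, rule ccontr)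
    fix x y assume a: "x \<in> Y" "y \<in> Y" "h x = h y" "x \<noteq> y"
    then have "trek_Left (\<tau> x) \<inter> trek_Left (\<tau> y) = {}" using sys by (auto simp: trek_system_nsi_def)
    then show False using hL[OF a(1)] hL[OF a(2)] a(3) by auto
  qed
  have h_htr: "h y = y" if "y \<in> Y" "y \<in> htr D B v" for y
    using half_trek_Left(2)[OF ht[of y]] tr(2)[of y] that by (simp add: h_def)
  have h_nhtr: "h y \<notin> {v} \<union> sib B v \<union> htr D B v" if "y \<in> Y" "y \<notin> htr D B v" for y
  proof
    assume "h y \<in> {v} \<union> sib B v \<union> htr D B v"
    then obtain xs where xs: "directed_chain D xs" "v = hd xs \<or> (v, hd xs) \<in> B" "last xs = h y"
    proof -
      have "\<exists>xs. directed_chain D xs \<and> (v = hd xs \<or> (v, hd xs) \<in> B) \<and> last xs = h y"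
        using \<open>h y \<in> {v} \<union> sib B v \<union> htr D B v\<close>
      proof (elim UnE)
        assume "h y \<in> {v}" then show ?thesis by (intro exI[of _ "[v]"]) simp
      next
        assume "h y \<in> sib B v" then show ?thesis using assms(1)
          by (intro exI[of _ "[h y]"]) (auto simp: sib_def sym_def)
      next
        assume "h y \<in> htr D B v" then show ?thesis by (auto simp: mem_htr_iff)
      qed
      then show thesis using that by blast
    qed
    have L: "directed_chain D (fst (\<tau> y))" "last (fst (\<tau> y)) = y"
      using tr[OF that(1)] by (auto simp: is_trek_def trek_src_def)
    \<comment> \<open>The left side of a trek is listed from its top down to its source, so it
      continues the half-trek from v to \<open>h y\<close> down to \<open>y\<close>;
      \<open>tl\<close> drops the node that the two share.\<close>
    let ?zs = "xs @ tl (fst (\<tau> y))"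
    have xsne: "xs \<noteq> []" using xs(1) by (simp add: directed_chain_def)
    have eq: "fst (\<tau> y) = h y # tl (fst (\<tau> y))" using ne[OF that(1)] by (simp add: h_def)
    have "directed_chain D ?zs \<and> last ?zs = y"
    proof (cases "tl (fst (\<tau> y)) = []")
      case True
      then have "h y = y" using eq L(2) by (metis last_ConsL)
      then show ?thesis using True xs by simp
    next
      case False
      have "(h y, hd (tl (fst (\<tau> y)))) \<in> D" "directed_chain D (tl (fst (\<tau> y)))"
        using L(1) False eq directed_chain_Cons by metis+
      moreover have "last (tl (fst (\<tau> y))) = y" using L(2) False by (simp add: last_tl)
      ultimately show ?thesis using False xs xsne by (auto simp: directed_chain_append)
    qed
    moreover have "hd ?zs = hd xs" using xsne by simp
    moreover have "y \<notin> {v} \<union> sib B v" using dis that(1) by blast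
    ultimately have "y \<in> htr D B v" unfolding mem_htr_iff using xs(2) by metis
    then show False using that(2) by blast
  qed
  define Y' where "Y' = h ` Y"
  define g where "g = the_inv_into Y h"
  have bij: "bij_betw g Y' Y" unfolding g_def Y'_def
    by (rule bij_betw_the_inv_into) (simp add: inj bij_betw_def)
  have hg: "h (g z) = z" "g z \<in> Y" if "z \<in> Y'" for z
    using that inj unfolding g_def Y'_def
    by (auto simp: f_the_inv_into_f the_inv_into_into)
  define \<tau>' where "\<tau>' z = ([z], snd (\<tau> (g z)))" for z
  have half: "is_half_trek D B (\<tau>' z)" if "z \<in> Y'" for z
    using tr(1)[OF hg(2)[OF that]] hg(1)[OF that] by (auto simp: \<tau>'_def is_trek_def h_def)
  have "trek_system_nsi D B Y' (pa D v) \<tau>'"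
    unfolding trek_system_nsi_def
  proof (intro conjI ballI impI)
    fix z assume "z \<in> Y'"
    then show "is_trek D B (\<tau>' z)" using half by (auto simp: is_half_trek_def)
    show "trek_src (\<tau>' z) = z" by (simp add: \<tau>'_def trek_src_def)
  next
    have "bij_betw (trek_tgt \<circ> \<tau>) Y (pa D v)" using sys by (simp add: trek_system_nsi_def)
    from bij_betw_trans[OF bij this]
    show "bij_betw (trek_tgt \<circ> \<tau>') Y' (pa D v)"
      by (simp add: comp_def \<tau>'_def trek_tgt_def)
  next
    fix x y assume a: "x \<in> Y'" "y \<in> Y'" "x \<noteq> y"
    then show "trek_Left (\<tau>' x) \<inter> trek_Left (\<tau>' y) = {}"
      by (simp add: \<tau>'_def trek_Left_def)
    have "g x \<noteq> g y" using a hg by metis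
    then have "trek_Right (\<tau> (g x)) \<inter> trek_Right (\<tau> (g y)) = {}"
      using sys hg a by (auto simp: trek_system_nsi_def)
    then show "trek_Right (\<tau>' x) \<inter> trek_Right (\<tau>' y) = {}"
      by (simp add: \<tau>'_def trek_Right_def)
  qed
  moreover have "card Y' = card (pa D v)" using card inj by (simp add: Y'_def card_image)
  moreover have "Y' \<inter> ({v} \<union> sib B v) = {}"
    using h_htr h_nhtr dis unfolding Y'_def by fastforce
  moreover have "Y' \<inter> htr D B v = Y \<inter> htr D B v"
  proof
    show "Y' \<inter> htr D B v \<subseteq> Y \<inter> htr D B v" using h_htr h_nhtr unfolding Y'_def by fastforce
    show "Y \<inter> htr D B v \<subseteq> Y' \<inter> htr D B v" using h_htr unfolding Y'_def by force
  qed
  ultimately show ?thesis unfolding HTC_def using half by blast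
qed

lemma weak_HTC_family_iff_HTC_identifiable:
  assumes "sym B"
  shows "(\<exists>Y r. (\<forall>v. weak_HTC D B (Y v) v) \<and> strict_linear_order r \<and>
              (\<forall>v w. w \<in> Y v \<inter> htr D B v \<longrightarrow> (w, v) \<in> r)) \<longleftrightarrow> HTC_identifiable D B"
proof
  assume "\<exists>Y r. (\<forall>v. weak_HTC D B (Y v) v) \<and> strict_linear_order r \<and>
              (\<forall>v w. w \<in> Y v \<inter> htr D B v \<longrightarrow> (w, v) \<in> r)"
  then obtain Y r where Y: "\<forall>v. weak_HTC D B (Y v) v" "strict_linear_order r"
    "\<forall>v w. w \<in> Y v \<inter> htr D B v \<longrightarrow> (w, v) \<in> r" by blast
  have "\<forall>v. \<exists>Z. HTC D B Z v \<and> Z \<inter> htr D B v = Y v \<inter> htr D B v"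
    using weak_HTC_imp_HTC[OF assms] Y(1) by blast
  then obtain Z where "\<forall>v. HTC D B (Z v) v \<and> Z v \<inter> htr D B v = Y v \<inter> htr D B v" by metis
  then show "HTC_identifiable D B" unfolding HTC_identifiable_def
    using Y by (intro exI[of _ Z] exI[of _ r] conjI) (simp_all)
next
  assume "HTC_identifiable D B"
  then obtain Y r where "\<forall>v. HTC D B (Y v) v" "strict_linear_order r"
    "\<forall>v w. w \<in> Y v \<inter> htr D B v \<longrightarrow> (w, v) \<in> r" unfolding HTC_identifiable_def by blast
  then show "\<exists>Y r. (\<forall>v. weak_HTC D B (Y v) v) \<and> strict_linear_order r \<and>
              (\<forall>v w. w \<in> Y v \<inter> htr D B v \<longrightarrow> (w, v) \<in> r)"
    by (intro exI[of _ Y] exI[of _ r] conjI) (auto intro: HTC_imp_weak_HTC)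
qed

lemma weak_HTC_families_iff_HTC_infinite_to_one:
  fixes D B :: "('n::finite \<times> 'n) set"
  assumes "sym B"
  shows "(\<forall>Y :: 'n \<Rightarrow> 'n set. (\<exists>v. \<not> weak_HTC D B (Y v) v) \<or>
                 (\<exists>v w. v \<noteq> w \<and> v \<in> Y w \<and> w \<in> Y v)) \<longleftrightarrow> HTC_infinite_to_one D B"
proof
  assume h: "HTC_infinite_to_one D B"
  show "\<forall>Y :: 'n \<Rightarrow> 'n set. (\<exists>v. \<not> weak_HTC D B (Y v) v) \<or>
                 (\<exists>v w. v \<noteq> w \<and> v \<in> Y w \<and> w \<in> Y v)"
  proof (intro allI, rule ccontr)
    fix Y :: "'n \<Rightarrow> 'n set"
    assume n: "\<not> ((\<exists>v. \<not> weak_HTC D B (Y v) v) \<or> (\<exists>v w. v \<noteq> w \<and> v \<in> Y w \<and> w \<in> Y v))"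
    have weak: "weak_HTC D B (Y v) v" for v using n by simp
    have disj: "w \<in> Y v \<Longrightarrow> v \<notin> Y w" if "v \<noteq> w" for v w using n that by auto
    have "\<forall>v. \<exists>Z. HTC D B Z v \<and> Z \<inter> htr D B v = Y v \<inter> htr D B v"
      by (intro allI weak_HTC_imp_HTC[OF assms] weak)
    then obtain Z where Z: "\<And>v. HTC D B (Z v) v" "\<And>v. Z v \<inter> htr D B v = Y v \<inter> htr D B v" by metis
    from h[unfolded HTC_infinite_to_one_def, rule_format, of Z] Z(1)
    obtain v w where vw: "v \<noteq> w" "v \<in> Z w" "w \<in> Z v" by auto
    have "w \<in> htr D B v" "v \<in> htr D B w" using HTC_mem_imp_htr[OF assms Z(1)] vw by auto
    then have "w \<in> Y v" "v \<in> Y w" using vw Z(2) by (metis IntD1 IntI)+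
    then show False using disj vw(1) by simp
  qed
next
  assume h: "\<forall>Y :: 'n \<Rightarrow> 'n set. (\<exists>v. \<not> weak_HTC D B (Y v) v) \<or>
                 (\<exists>v w. v \<noteq> w \<and> v \<in> Y w \<and> w \<in> Y v)"
  show "HTC_infinite_to_one D B" unfolding HTC_infinite_to_one_def
  proof
    fix Y :: "'n \<Rightarrow> 'n set"
    show "(\<exists>v. \<not> HTC D B (Y v) v) \<or> (\<exists>v w. v \<noteq> w \<and> v \<in> Y w \<and> w \<in> Y v)"
      using h[rule_format, of Y] HTC_imp_weak_HTC[of D B "Y v" v for v] by auto
  qed
qed

subsection \<open>Polynomial and rational functions\<close>

lemma polyfun_prod: "(\<And>i. i \<in> I \<Longrightarrow> polyfun (p i)) \<Longrightarrow> polyfun (\<lambda>x. \<Prod>i\<in>I. p i x)"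
  by (induction I rule: infinite_finite_induct) (auto intro: pf_const pf_mult)

lemma polyfun_on_line:
  assumes "polyfun p"
  shows "\<exists>r. \<forall>t. p (\<lambda>i. a i + t * b i) = poly r t"
  using assms
proof induction
  case (pf_const c)
  show ?case by (intro exI[of _ "[:c:]"]) simp
next
  case (pf_var i)
  show ?case by (intro exI[of _ "[:a i, b i:]"]) simp
next
  case (pf_add p q)
  then obtain r s where "\<forall>t. p (\<lambda>i. a i + t * b i) = poly r t" "\<forall>t. q (\<lambda>i. a i + t * b i) = poly s t"
    by blast
  then show ?case by (intro exI[of _ "r + s"]) simp
next
  case (pf_mult p q)
  then obtain r s where "\<forall>t. p (\<lambda>i. a i + t * b i) = poly r t" "\<forall>t. q (\<lambda>i. a i + t * b i) = poly s t"
    by blast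
  then show ?case by (intro exI[of _ "r * s"]) simp
qed

lemma polyfun_finite_roots_on_line:
  assumes "polyfun p" "p (\<lambda>i. a i + t0 * b i) \<noteq> 0"
  shows "finite {t. p (\<lambda>i. a i + t * b i) = 0}"
proof -
  obtain r where r: "\<And>t. p (\<lambda>i. a i + t * b i) = poly r t" using polyfun_on_line[OF assms(1)] by blast
  then have "r \<noteq> 0" using assms(2) by (metis poly_0)
  then show ?thesis using r poly_roots_finite by simp
qed

text \<open>The denominator must not vanish anywhere on \<open>S\<close>, so exceptional points are
  removed from \<open>S\<close> beforehand. The coordinate map \<open>c\<close> is a parameter
  because the same closure rules serve functions of the parameters, of Sigma, of one real variable
  and of vectors.\<close>

definition rational_on :: "('a \<Rightarrow> 'i \<Rightarrow> real) \<Rightarrow> 'a set \<Rightarrow> ('a \<Rightarrow> real) \<Rightarrow> bool" where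
  "rational_on c S g \<longleftrightarrow>
     (\<exists>p q. polyfun p \<and> polyfun q \<and> (\<forall>s\<in>S. q (c s) \<noteq> 0 \<and> g s = p (c s) / q (c s)))"

lemma rational_onI:
  assumes "polyfun p" "polyfun q" "\<And>s. s \<in> S \<Longrightarrow> q (c s) \<noteq> 0" "\<And>s. s \<in> S \<Longrightarrow> g s = p (c s) / q (c s)"
  shows "rational_on c S g"
  using assms unfolding rational_on_def by blast

lemma rational_on_const: "rational_on c S (\<lambda>s. a)"
  by (rule rational_onI[OF pf_const[of a] pf_const[of 1]]) auto

lemma rational_on_coord: "rational_on c S (\<lambda>s. c s i)"
  by (rule rational_onI[OF pf_var[of i] pf_const[of 1]]) auto

lemma rational_on_cong: "(\<And>s. s \<in> S \<Longrightarrow> g s = h s) \<Longrightarrow> rational_on c S g \<longleftrightarrow> rational_on c S h"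
  unfolding rational_on_def by simp

lemma rational_on_add:
  assumes "rational_on c S g" "rational_on c S h"
  shows "rational_on c S (\<lambda>s. g s + h s)"
proof -
  obtain p q where g: "polyfun p" "polyfun q" "\<forall>s\<in>S. q (c s) \<noteq> 0 \<and> g s = p (c s) / q (c s)"
    using assms(1) unfolding rational_on_def by blast
  obtain p' q' where h: "polyfun p'" "polyfun q'" "\<forall>s\<in>S. q' (c s) \<noteq> 0 \<and> h s = p' (c s) / q' (c s)"
    using assms(2) unfolding rational_on_def by blast
  show ?thesis
    by (rule rational_onI[of "\<lambda>x. p x * q' x + p' x * q x" "\<lambda>x. q x * q' x"])
       (use g h in \<open>auto intro!: pf_add pf_mult simp: add_frac_eq\<close>)
qed

lemma rational_on_mult:
  assumes "rational_on c S g" "rational_on c S h"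
  shows "rational_on c S (\<lambda>s. g s * h s)"
proof -
  obtain p q where g: "polyfun p" "polyfun q" "\<forall>s\<in>S. q (c s) \<noteq> 0 \<and> g s = p (c s) / q (c s)"
    using assms(1) unfolding rational_on_def by blast
  obtain p' q' where h: "polyfun p'" "polyfun q'" "\<forall>s\<in>S. q' (c s) \<noteq> 0 \<and> h s = p' (c s) / q' (c s)"
    using assms(2) unfolding rational_on_def by blast
  show ?thesis
    by (rule rational_onI[of "\<lambda>x. p x * p' x" "\<lambda>x. q x * q' x"])
       (use g h in \<open>auto intro!: pf_mult\<close>)
qed

lemma rational_on_divide:
  assumes "rational_on c S g" "rational_on c S h" "\<And>s. s \<in> S \<Longrightarrow> h s \<noteq> 0"
  shows "rational_on c S (\<lambda>s. g s / h s)"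
proof -
  obtain p q where h: "polyfun p" "polyfun q" "\<forall>s\<in>S. q (c s) \<noteq> 0 \<and> h s = p (c s) / q (c s)"
    using assms(2) unfolding rational_on_def by blast
  have "rational_on c S (\<lambda>s. 1 / h s)"
    by (rule rational_onI[of q p]) (use h assms(3) in force)+
  from rational_on_mult[OF assms(1) this] show ?thesis by simp
qed

lemma rational_on_uminus: "rational_on c S g \<Longrightarrow> rational_on c S (\<lambda>s. - g s)"
  using rational_on_mult[OF rational_on_const[of c S "-1"], of g] by simp

lemma rational_on_diff:
  "rational_on c S g \<Longrightarrow> rational_on c S h \<Longrightarrow> rational_on c S (\<lambda>s. g s - h s)"
  using rational_on_add[OF _ rational_on_uminus, of c S g h] by simp

lemma rational_on_sum:
  "(\<And>i. i \<in> I \<Longrightarrow> rational_on c S (g i)) \<Longrightarrow> rational_on c S (\<lambda>s. \<Sum>i\<in>I. g i s)"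
  by (induction I rule: infinite_finite_induct) (auto intro: rational_on_const rational_on_add)

lemma rational_on_prod:
  "(\<And>i. i \<in> I \<Longrightarrow> rational_on c S (g i)) \<Longrightarrow> rational_on c S (\<lambda>s. \<Prod>i\<in>I. g i s)"
  by (induction I rule: infinite_finite_induct) (auto intro: rational_on_const rational_on_mult)

lemma polyfun_rational_on: "polyfun p \<Longrightarrow> rational_on c S (\<lambda>s. p (c s))"
  by (rule rational_onI[OF _ pf_const[of 1]]) auto

text \<open>Take the numerator. In this way a condition that involves inverse matrices becomes a
  polynomial one, as \<open>proper_algebraic_subset\<close> requires.\<close>

lemma rational_on_zeros:
  assumes "rational_on c S g"
  obtains p where "polyfun p" "\<And>s. s \<in> S \<Longrightarrow> p (c s) = 0 \<longleftrightarrow> g s = 0"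
proof -
  obtain p q where p: "polyfun p" "\<forall>s\<in>S. q (c s) \<noteq> 0 \<and> g s = p (c s) / q (c s)"
    using assms unfolding rational_on_def by blast
  then show thesis using that[of p] by simp
qed

section \<open>Matrices of rational functions, Cramer's rule and inverses\<close>

definition rational_matrix_on ::
    "('a \<Rightarrow> 'i \<Rightarrow> real) \<Rightarrow> 'a set \<Rightarrow> ('a \<Rightarrow> real^'n^'m) \<Rightarrow> bool" where
  "rational_matrix_on c S A \<longleftrightarrow> (\<forall>i j. rational_on c S (\<lambda>s. A s $ i $ j))"

lemma rational_matrix_on_const: "rational_matrix_on c S (\<lambda>s. A)"
  by (simp add: rational_matrix_on_def rational_on_const)

lemma rational_matrix_on_diff:
  "rational_matrix_on c S A \<Longrightarrow> rational_matrix_on c S A' \<Longrightarrow> rational_matrix_on c S (\<lambda>s. A s - A' s)"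
  by (simp add: rational_matrix_on_def rational_on_diff)

lemma rational_matrix_on_transpose:
  "rational_matrix_on c S A \<Longrightarrow> rational_matrix_on c S (\<lambda>s. transpose (A s))"
  by (simp add: rational_matrix_on_def transpose_def)

lemma rational_matrix_on_mult:
  "rational_matrix_on c S A \<Longrightarrow> rational_matrix_on c S A' \<Longrightarrow> rational_matrix_on c S (\<lambda>s. A s ** A' s)"
  by (simp add: rational_matrix_on_def matrix_matrix_mult_def rational_on_sum rational_on_mult)

lemma rational_on_det:
  fixes A :: "'a \<Rightarrow> real^'n^'n"
  assumes "rational_matrix_on c S A"
  shows "rational_on c S (\<lambda>s. det (A s))"
  using assms unfolding det_def rational_matrix_on_def
  by (intro rational_on_sum rational_on_mult rational_on_prod rational_on_const) auto

lemma matrix_inv_inverse: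
  fixes A :: "real^'n^'n"
  assumes "invertible A"
  shows "A ** matrix_inv A = mat 1" "matrix_inv A ** A = mat 1"
  using someI_ex[OF assms[unfolded invertible_def]] by (auto simp: matrix_inv_def)

text \<open>Cramer's rule writes each entry of a given solution as a quotient of determinants. It
  serves for the columns of inverse matrices and later for the columns of Lambda.\<close>

lemma rational_on_cramer:
  fixes A :: "'a \<Rightarrow> real^'n^'n"
  assumes "rational_matrix_on c S A" "\<And>i. rational_on c S (\<lambda>s. b s $ i)"
    "\<And>s. s \<in> S \<Longrightarrow> det (A s) \<noteq> 0" "\<And>s. s \<in> S \<Longrightarrow> A s *v x s = b s"
  shows "rational_on c S (\<lambda>s. x s $ k)"
proof -
  let ?M = "\<lambda>s. \<chi> i j. if j = k then b s $ i else A s $ i $ j"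
  have "x s $ k = det (?M s) / det (A s)" if "s \<in> S" for s
    using cramer[OF assms(3)[OF that], of "x s" "b s"] assms(4)[OF that] by simp
  moreover have "rational_on c S (\<lambda>s. ?M s $ i $ j)" for i j
    using assms(1,2) unfolding rational_matrix_on_def by (cases "j = k") simp_all
  then have "rational_matrix_on c S ?M"
    unfolding rational_matrix_on_def by blast
  then have "rational_on c S (\<lambda>s. det (?M s) / det (A s))"
    by (intro rational_on_divide rational_on_det assms) auto
  ultimately show ?thesis
    using rational_on_cong[of S "\<lambda>s. x s $ k" "\<lambda>s. det (?M s) / det (A s)" c] by blast
qed

lemma rational_matrix_on_inv:
  fixes A :: "'a \<Rightarrow> real^'n^'n"
  assumes "rational_matrix_on c S A" "\<And>s. s \<in> S \<Longrightarrow> det (A s) \<noteq> 0"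
  shows "rational_matrix_on c S (\<lambda>s. matrix_inv (A s))"
  unfolding rational_matrix_on_def
proof (intro allI)
  fix i j
  have "A s *v column j (matrix_inv (A s)) = column j (mat 1)" if "s \<in> S" for s
  proof -
    have "A s *v column j (matrix_inv (A s)) = column j (A s ** matrix_inv (A s))"
      by (simp add: vec_eq_iff column_def matrix_matrix_mult_def matrix_vector_mult_def)
    then show ?thesis using matrix_inv_inverse(1)[of "A s"] assms(2)[OF that]
      by (simp add: invertible_det_nz)
  qed
  then have "rational_on c S (\<lambda>s. column j (matrix_inv (A s)) $ i)"
    by (intro rational_on_cramer[OF assms(1) rational_on_const assms(2)])
  then show "rational_on c S (\<lambda>s. matrix_inv (A s) $ i $ j)" by (simp add: column_def)
qed

subsection \<open>Generic points of the parameter space\<close>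

text \<open>Polynomials are tested for nonvanishing on this larger set, where positive definiteness
  is dropped.\<close>
definition regular_pairs ::
    "('n::finite \<times> 'n) set \<Rightarrow> ('n \<times> 'n) set \<Rightarrow> ((real^'n^'n) \<times> (real^'n^'n)) set" where
  "regular_pairs D B = RDreg D \<times>
     {\<Omega>. transpose \<Omega> = \<Omega> \<and> (\<forall>v w. v \<noteq> w \<and> (v, w) \<notin> B \<longrightarrow> \<Omega> $ v $ w = 0)}"

lemma Theta_subset_regular_pairs: "Theta D B \<subseteq> regular_pairs D B"
  by (auto simp: Theta_def regular_pairs_def PD_def)

lemma invertible_regular_pairs: "\<theta> \<in> regular_pairs D B \<Longrightarrow> det (mat 1 - fst \<theta>) \<noteq> 0"
  by (auto simp: regular_pairs_def RDreg_def invertible_det_nz)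

lemma identity_in_regular_pairs: "(0, mat 1) \<in> regular_pairs D B"
  by (auto simp: regular_pairs_def RDreg_def invertible_det_nz transpose_mat) (simp add: mat_def)

lemma theta_coords_line:
  "theta_coords (\<theta>1 + t *\<^sub>R \<theta>2) = (\<lambda>i. theta_coords \<theta>1 i + t * theta_coords \<theta>2 i)"
  by (rule ext) (auto simp: theta_coords_def split: sum.split)

lemma rational_matrix_on_theta:
  "rational_matrix_on theta_coords S fst" "rational_matrix_on theta_coords S snd"
  unfolding rational_matrix_on_def
  using rational_on_coord[of theta_coords S "Inl (i, j)" for i j]
    rational_on_coord[of theta_coords S "Inr (i, j)" for i j]
  by (simp_all add: theta_coords_def)

lemma det_polyfun:
  obtains p :: "(('n::finite \<times> 'n) + ('n \<times> 'n) \<Rightarrow> real) \<Rightarrow> real"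
  where "polyfun p" "\<And>\<theta>. p (theta_coords \<theta>) = 0 \<longleftrightarrow> det (mat 1 - fst \<theta> :: real^'n^'n) = 0"
proof -
  have "rational_on theta_coords UNIV (\<lambda>\<theta>. det (mat 1 - fst \<theta> :: real^'n^'n))"
    by (intro rational_on_det rational_matrix_on_diff rational_matrix_on_const rational_matrix_on_theta)
  from rational_on_zeros[OF this] show thesis using that by (metis UNIV_I)
qed

text \<open>The zero pattern and the symmetry are linear and hold on the whole line. What remains
  are two univariate polynomials, the determinant of I - Lambda, nonzero at 0, and \<open>f\<close>,
  nonzero at \<open>t0\<close>; each has finitely many roots.\<close>

lemma finite_exceptions_on_line:
  fixes D B :: "('n::finite \<times> 'n) set"
  assumes "\<theta>1 \<in> regular_pairs D B" "\<theta>2 \<in> regular_pairs D B"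
    and "polyfun f" "f (theta_coords (\<theta>1 + t0 *\<^sub>R (\<theta>2 - \<theta>1))) \<noteq> 0"
  shows "finite {t. \<not> (\<theta>1 + t *\<^sub>R (\<theta>2 - \<theta>1) \<in> regular_pairs D B \<and>
                    f (theta_coords (\<theta>1 + t *\<^sub>R (\<theta>2 - \<theta>1))) \<noteq> 0)}" (is "finite ?E")
proof -
  obtain p where p: "polyfun p"
      "\<And>\<theta>. p (theta_coords \<theta>) = 0 \<longleftrightarrow> det (mat 1 - fst \<theta> :: real^'n^'n) = 0"
    using det_polyfun by blast
  let ?l = "\<lambda>t. \<theta>1 + t *\<^sub>R (\<theta>2 - \<theta>1)"
  have "p (theta_coords (?l 0)) \<noteq> 0" using p(2) invertible_regular_pairs[OF assms(1)] by simp
  then have "finite {t. p (theta_coords (?l t)) = 0}" 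
    using polyfun_finite_roots_on_line[OF p(1)] unfolding theta_coords_line by blast
  moreover have "finite {t. f (theta_coords (?l t)) = 0}"
    using assms(4) polyfun_finite_roots_on_line[OF assms(3)] unfolding theta_coords_line by blast
  moreover have "?l t \<in> regular_pairs D B" if "p (theta_coords (?l t)) \<noteq> 0" for t
    using assms(1,2) that unfolding p(2)
    by (auto simp: regular_pairs_def RDreg_def invertible_det_nz transpose_def vec_eq_iff)
  then have "?E \<subseteq> {t. p (theta_coords (?l t)) = 0} \<union> {t. f (theta_coords (?l t)) = 0}" by blast
  ultimately show ?thesis using finite_subset by blast
qed

text \<open>This takes the place of irreducibility of the parameter space: on the line through the
  two points \<open>f\<close> is nonzero at 0 and \<open>g\<close> at 1, so some third point avoids
  the roots of both.\<close>

lemma nonzero_polyfun_mult: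
  assumes "polyfun f" "\<theta>1 \<in> regular_pairs D B" "f (theta_coords \<theta>1) \<noteq> 0"
    and "polyfun g" "\<theta>2 \<in> regular_pairs D B" "g (theta_coords \<theta>2) \<noteq> 0"
  shows "\<exists>\<theta>\<in>regular_pairs D B. f (theta_coords \<theta>) * g (theta_coords \<theta>) \<noteq> 0"
proof -
  let ?l = "\<lambda>t. \<theta>1 + t *\<^sub>R (\<theta>2 - \<theta>1)"
  have "finite ({t. \<not> (?l t \<in> regular_pairs D B \<and> f (theta_coords (?l t)) \<noteq> 0)} \<union>
                {t. \<not> (?l t \<in> regular_pairs D B \<and> g (theta_coords (?l t)) \<noteq> 0)})"
    by (intro finite_UnI finite_exceptions_on_line[OF assms(2,5,1), of 0]
        finite_exceptions_on_line[OF assms(2,5,4), of 1]) (use assms in simp_all)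
  from ex_new_if_finite[OF infinite_UNIV_char_0 this] show ?thesis by auto
qed

lemma nonzero_polyfun_prod:
  assumes "finite I" "\<And>i. i \<in> I \<Longrightarrow> polyfun (f i)"
    "\<And>i. i \<in> I \<Longrightarrow> \<exists>\<theta>\<in>regular_pairs D B. f i (theta_coords \<theta>) \<noteq> 0"
  shows "\<exists>\<theta>\<in>regular_pairs D B. (\<Prod>i\<in>I. f i (theta_coords \<theta>)) \<noteq> 0"
  using assms
proof (induction I rule: finite_induct)
  case empty
  then show ?case using identity_in_regular_pairs by auto
next
  case (insert i I)
  then obtain \<theta>1 \<theta>2 where "\<theta>1 \<in> regular_pairs D B" "f i (theta_coords \<theta>1) \<noteq> 0"
    "\<theta>2 \<in> regular_pairs D B" "(\<Prod>i\<in>I. f i (theta_coords \<theta>2)) \<noteq> 0" by (metis insertCI)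
  with nonzero_polyfun_mult[of "f i" \<theta>1 D B "\<lambda>x. \<Prod>i\<in>I. f i x" \<theta>2] insert
  show ?case by (simp add: polyfun_prod)
qed

lemma pencil_from_identity_PD:
  fixes \<Omega> :: "real^'n^'n"
  shows "\<exists>\<delta>>0. \<forall>t. 0 < t \<and> t < \<delta> \<longrightarrow>
    (\<forall>x. x \<noteq> 0 \<longrightarrow> x \<bullet> ((mat 1 + t *\<^sub>R (\<Omega> - mat 1)) *v x) > 0)"
proof -
  define K where "K = onorm ((*v) \<Omega>)"
  have K: "norm (\<Omega> *v x) \<le> K * norm x" for x
    unfolding K_def by (rule onorm) simp
  have K0: "K \<ge> 0" unfolding K_def by (rule onorm_pos_le) simp
  \<comment> \<open>As K is the operator norm of Omega, the quadratic form is at least (1 - t - t K)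
    times |x|^2, which is positive for t < 1 / (1 + K).\<close>
  show ?thesis
  proof (intro exI[of _ "1 / (1 + K)"] conjI allI impI)
    show "1 / (1 + K) > 0" using K0 by simp
    fix t and x :: "real^'n" assume t: "0 < t \<and> t < 1 / (1 + K)" and x: "x \<noteq> 0"
    have t1: "t * (1 + K) < 1" using t K0 by (simp add: field_simps)
    have "\<bar>x \<bullet> (\<Omega> *v x)\<bar> \<le> norm x * norm (\<Omega> *v x)" by (rule Cauchy_Schwarz_ineq2)
    also have "\<dots> \<le> norm x * (K * norm x)" using K by (intro mult_left_mono) auto
    also have "\<dots> = K * (x \<bullet> x)" by (simp add: dot_square_norm power2_eq_square)
    finally have "x \<bullet> (\<Omega> *v x) \<ge> - (K * (x \<bullet> x))" by linarith
    then have "t * (x \<bullet> (\<Omega> *v x)) \<ge> t * - (K * (x \<bullet> x))" using t by (intro mult_left_mono) auto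
    moreover have "x \<bullet> ((mat 1 + t *\<^sub>R (\<Omega> - mat 1)) *v x) = (1 - t) * (x \<bullet> x) + t * (x \<bullet> (\<Omega> *v x))"
      by (simp add: matrix_vector_mult_add_rdistrib scaleR_matrix_vector_assoc [symmetric]
          matrix_vector_mult_diff_rdistrib inner_add_right inner_diff_right algebra_simps)
    moreover have "(1 - t * (1 + K)) * (x \<bullet> x) > 0" using t1 x by simp
    ultimately show "x \<bullet> ((mat 1 + t *\<^sub>R (\<Omega> - mat 1)) *v x) > 0" by (simp add: algebra_simps)
  qed
qed

text \<open>On the line from (0, I) to the given point, all small positive t give a positive
  definite second component, and only finitely many of them can be exceptions.\<close>

lemma nonzero_polyfun_Theta:
  assumes "polyfun f" "\<theta> \<in> regular_pairs D B" "f (theta_coords \<theta>) \<noteq> 0"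
  shows "\<exists>\<theta>'\<in>Theta D B. f (theta_coords \<theta>') \<noteq> 0"
proof -
  let ?l = "\<lambda>t. (0, mat 1) + t *\<^sub>R (\<theta> - (0, mat 1))"
  obtain \<delta> where \<delta>: "\<delta> > 0" "\<And>t x. 0 < t \<Longrightarrow> t < \<delta> \<Longrightarrow> x \<noteq> 0 \<Longrightarrow>
      x \<bullet> ((mat 1 + t *\<^sub>R (snd \<theta> - mat 1)) *v x) > 0"
    using pencil_from_identity_PD[of "snd \<theta>"] by blast
  have "finite {t. \<not> (?l t \<in> regular_pairs D B \<and> f (theta_coords (?l t)) \<noteq> 0)}"
    by (rule finite_exceptions_on_line[OF identity_in_regular_pairs assms(2,1), of 1])
       (use assms in simp)
  then have "\<not> {0<..<\<delta>} \<subseteq> {t. \<not> (?l t \<in> regular_pairs D B \<and> f (theta_coords (?l t)) \<noteq> 0)}"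
    using \<delta>(1) finite_subset infinite_Ioo by blast
  then obtain t where t: "0 < t" "t < \<delta>" "?l t \<in> regular_pairs D B" "f (theta_coords (?l t)) \<noteq> 0"
    unfolding subset_eq Ball_def mem_Collect_eq greaterThanLessThan_iff by blast
  have "?l t = (t *\<^sub>R fst \<theta>, mat 1 + t *\<^sub>R (snd \<theta> - mat 1))" by (simp add: prod_eq_iff)
  then have "?l t \<in> Theta D B"
    using t(3) \<delta>(2)[OF t(1,2)] by (auto simp: Theta_def regular_pairs_def PD_def)
  then show ?thesis using t(4) by blast
qed

lemma proper_algebraic_subset_zeros:
  assumes "polyfun f" "\<theta> \<in> regular_pairs D B" "f (theta_coords \<theta>) \<noteq> 0"
  shows "proper_algebraic_subset D B {\<theta> \<in> Theta D B. f (theta_coords \<theta>) = 0}"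
  unfolding proper_algebraic_subset_def
  using nonzero_polyfun_Theta[OF assms] assms(1) by (intro conjI exI[of _ "{f}"]) auto

subsection \<open>Solvability of the half-trek systems\<close>

text \<open>Determinants are taken over the full index type. Completing the P x P block by the
  identity makes the determinant that of the block.\<close>

definition pad :: "'n set \<Rightarrow> real^'n^'n \<Rightarrow> real^'n^'n" where
  "pad P M = (\<chi> x z. if x \<in> P \<and> z \<in> P then M $ x $ z else if x = z then 1 else 0)"

text \<open>The block of a product differs from the product of the blocks only by the terms with
  inner index outside \<open>P\<close>, and the hypothesis makes these vanish. So the determinant of
  the block is multiplicative here, with no Cauchy-Binet sum.\<close>

lemma pad_mult:
  assumes "\<And>x k. k \<notin> P \<Longrightarrow> M $ x $ k = 0"
  shows "pad P M ** pad P M' = pad P (M ** M')"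
proof -
  have "(\<Sum>k\<in>UNIV. pad P M $ x $ k * pad P M' $ k $ z) = pad P (M ** M') $ x $ z" for x z
  proof (cases "x \<in> P")
    case True
    have "pad P M $ x $ k * pad P M' $ k $ z = (if z \<in> P then M $ x $ k * M' $ k $ z else 0)" for k
      using True assms[of k x] by (auto simp: pad_def)
    then have "(\<Sum>k\<in>UNIV. pad P M $ x $ k * pad P M' $ k $ z) =
        (\<Sum>k\<in>UNIV. if z \<in> P then M $ x $ k * M' $ k $ z else 0)" by (intro sum.cong) auto
    then show ?thesis using True by (auto simp: pad_def matrix_matrix_mult_def)
  next
    case False
    then have "pad P M $ x $ k * pad P M' $ k $ z = (if k = x then (if x = z then 1 else 0) else 0)" for k
      by (auto simp: pad_def)
    then show ?thesis using False by (simp add: pad_def)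
  qed
  then show ?thesis by (simp add: vec_eq_iff matrix_matrix_mult_def)
qed

lemma pad_eq_mat_1:
  assumes "\<And>x z. x \<in> P \<Longrightarrow> z \<in> P \<Longrightarrow> M $ x $ z = (if x = z then 1 else 0)"
  shows "pad P M = mat 1"
  using assms by (auto simp: pad_def vec_eq_iff mat_def)

lemma rational_matrix_on_pad:
  assumes "rational_matrix_on c S M"
  shows "rational_matrix_on c S (\<lambda>s. pad P (M s))"
  unfolding rational_matrix_on_def
proof (intro allI)
  fix i j
  show "rational_on c S (\<lambda>s. pad P (M s) $ i $ j)"
    using assms by (cases "i \<in> P \<and> j \<in> P")
      (auto simp: pad_def rational_matrix_on_def intro: rational_on_const)
qed

text \<open>The row indexed by a parent x encodes the equation of the criterion's node sigma x; it is
  taken from (I - Lambda)^T Sigma only for nodes whose columns of Lambda are already known.\<close>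
definition htc_rows ::
    "('n::finite \<times> 'n) set \<Rightarrow> ('n \<times> 'n) set \<Rightarrow> 'n \<Rightarrow> ('n \<Rightarrow> 'n) \<Rightarrow> (real^'n^'n) \<times> (real^'n^'n) \<Rightarrow> real^'n^'n" where
  "htc_rows D B v \<sigma> \<theta> = (\<chi> x z. if \<sigma> x \<in> htr D B v
      then (transpose (mat 1 - fst \<theta>) ** phi \<theta>) $ \<sigma> x $ z else phi \<theta> $ \<sigma> x $ z)"

definition disjoint_chains ::
    "('n::finite \<times> 'n) set \<Rightarrow> 'n set \<Rightarrow> ('n \<Rightarrow> 'n list) \<Rightarrow> bool" where
  "disjoint_chains D P \<rho> \<longleftrightarrow>
     (\<forall>p\<in>P. directed_chain D (\<rho> p) \<and> distinct (\<rho> p) \<and> last (\<rho> p) = p) \<and>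
     (\<forall>p\<in>P. \<forall>p'\<in>P. p \<noteq> p' \<longrightarrow> set (\<rho> p) \<inter> set (\<rho> p') = {})"

text \<open>The system is reindexed by the parents where the half-treks end, so that rows and
  columns of the linear system at v both carry indices from \<open>pa D v\<close>. The chains are
  the loop-erased right sides.\<close>

lemma HTC_imp_disjoint_chains:
  assumes "HTC D B Y v"
  obtains \<sigma> \<rho> where "bij_betw \<sigma> (pa D v) Y" "disjoint_chains D (pa D v) \<rho>"
    "\<And>p. p \<in> pa D v \<Longrightarrow> \<sigma> p = hd (\<rho> p) \<or> (\<sigma> p, hd (\<rho> p)) \<in> B"
proof -
  obtain \<tau> where sys: "trek_system_nsi D B Y (pa D v) \<tau>"
    and ht: "\<And>y. y \<in> Y \<Longrightarrow> is_half_trek D B (\<tau> y)"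
    using assms by (auto simp: HTC_def)
  have bij: "bij_betw (trek_tgt \<circ> \<tau>) Y (pa D v)"
    and src: "\<And>y. y \<in> Y \<Longrightarrow> trek_src (\<tau> y) = y"
    and R: "\<And>x y. x \<in> Y \<Longrightarrow> y \<in> Y \<Longrightarrow> x \<noteq> y \<Longrightarrow> set (snd (\<tau> x)) \<inter> set (snd (\<tau> y)) = {}"
    using sys by (auto simp: trek_system_nsi_def trek_Right_def)
  have h: "directed_chain D (snd (\<tau> y))" "y = hd (snd (\<tau> y)) \<or> (y, hd (snd (\<tau> y))) \<in> B" if "y \<in> Y" for y
    using half_trek_singletonI[OF ht[OF that]] src[OF that] by auto
  define \<sigma> where "\<sigma> = the_inv_into Y (trek_tgt \<circ> \<tau>)"
  have b: "bij_betw \<sigma> (pa D v) Y" unfolding \<sigma>_def using bij by (rule bij_betw_the_inv_into)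
  have \<sigma>: "\<sigma> p \<in> Y" "last (snd (\<tau> (\<sigma> p))) = p" if "p \<in> pa D v" for p
    using that b bij f_the_inv_into_f[of "trek_tgt \<circ> \<tau>" Y p]
    by (auto simp: bij_betw_def \<sigma>_def trek_tgt_def)
  have "\<exists>ys. directed_chain D ys \<and> distinct ys \<and> hd ys = hd (snd (\<tau> (\<sigma> p))) \<and>
      last ys = last (snd (\<tau> (\<sigma> p))) \<and> set ys \<subseteq> set (snd (\<tau> (\<sigma> p)))" if "p \<in> pa D v" for p
    by (rule directed_chain_distinct[OF h(1)[OF \<sigma>(1)[OF that]]])
  then obtain \<rho> where \<rho>: "\<And>p. p \<in> pa D v \<Longrightarrow> directed_chain D (\<rho> p) \<and> distinct (\<rho> p) \<and>
      hd (\<rho> p) = hd (snd (\<tau> (\<sigma> p))) \<and> last (\<rho> p) = last (snd (\<tau> (\<sigma> p))) \<and>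
      set (\<rho> p) \<subseteq> set (snd (\<tau> (\<sigma> p)))" by metis
  show thesis
  proof (rule that[OF b])
    show "disjoint_chains D (pa D v) \<rho>" unfolding disjoint_chains_def
    proof (intro conjI ballI impI)
      fix p p' assume p: "p \<in> pa D v" "p' \<in> pa D v" "p \<noteq> p'"
      then have "\<sigma> p \<noteq> \<sigma> p'" using \<sigma>(2) by metis
      then have "set (snd (\<tau> (\<sigma> p))) \<inter> set (snd (\<tau> (\<sigma> p'))) = {}" using R \<sigma>(1) p by blast
      then show "set (\<rho> p) \<inter> set (\<rho> p') = {}" using \<rho>[OF p(1)] \<rho>[OF p(2)] by blast
    qed (use \<rho> \<sigma>(2) in auto)
    show "\<sigma> p = hd (\<rho> p) \<or> (\<sigma> p, hd (\<rho> p)) \<in> B" if "p \<in> pa D v" for p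
      using h(2)[OF \<sigma>(1)[OF that]] \<rho>[OF that] by simp
  qed
qed

section \<open>The 0/1 matrix of a family of disjoint simple paths\<close>

definition chain_edges :: "'n set \<Rightarrow> ('n \<Rightarrow> 'n list) \<Rightarrow> real^'n^'n" where
  "chain_edges P \<rho> = (\<chi> a b. if \<exists>p\<in>P. \<exists>i. Suc i < length (\<rho> p) \<and> \<rho> p ! i = a \<and> \<rho> p ! Suc i = b
     then 1 else 0)"

context
  fixes D :: "('n::finite \<times> 'n) set" and P :: "'n set" and \<rho> :: "'n \<Rightarrow> 'n list"
  assumes dc: "disjoint_chains D P \<rho>"
begin

lemma chain_index_unique:
  assumes "p \<in> P" "i < length (\<rho> p)" "q \<in> P" "j < length (\<rho> q)" "\<rho> p ! i = \<rho> q ! j"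
  shows "p = q \<and> i = j"
proof -
  have "p = q" 
  proof (rule ccontr)
    assume "p \<noteq> q"
    then have "set (\<rho> p) \<inter> set (\<rho> q) = {}" using dc assms(1,3) by (auto simp: disjoint_chains_def)
    then show False using assms(2,4,5) by (metis disjoint_iff nth_mem)
  qed
  then show ?thesis using assms dc by (auto simp: disjoint_chains_def nth_eq_iff_index_eq)
qed

lemma chain_nonempty: "p \<in> P \<Longrightarrow> \<rho> p \<noteq> []"
  using dc by (auto simp: disjoint_chains_def directed_chain_def)

lemma chain_last: "p \<in> P \<Longrightarrow> \<rho> p ! (length (\<rho> p) - 1) = p"
  using dc chain_nonempty by (auto simp: disjoint_chains_def last_conv_nth)

lemma chain_edges_step:
  assumes "p \<in> P" "Suc i < length (\<rho> p)"
  shows "((mat 1 - chain_edges P \<rho>) *v w) $ (\<rho> p ! i) = w $ (\<rho> p ! i) - w $ (\<rho> p ! Suc i)"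
proof -
  have "chain_edges P \<rho> $ (\<rho> p ! i) $ b = (if b = \<rho> p ! Suc i then 1 else 0)" for b
  proof -
    have "(\<exists>q\<in>P. \<exists>j. Suc j < length (\<rho> q) \<and> \<rho> q ! j = \<rho> p ! i \<and> \<rho> q ! Suc j = b) \<longleftrightarrow> b = \<rho> p ! Suc i"
      using assms chain_index_unique[OF assms(1) Suc_lessD[OF assms(2)]] by (metis Suc_lessD)
    then show ?thesis by (simp add: chain_edges_def)
  qed
  then have "chain_edges P \<rho> $ (\<rho> p ! i) $ b * w $ b = (if b = \<rho> p ! Suc i then w $ b else 0)" for b
    by simp
  then have "(chain_edges P \<rho> *v w) $ (\<rho> p ! i) = w $ (\<rho> p ! Suc i)"
    by (simp add: matrix_vector_mult_def)
  then show ?thesis by (simp add: matrix_vector_mult_diff_rdistrib)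
qed

lemma chain_edges_off:
  assumes "\<And>p i. p \<in> P \<Longrightarrow> Suc i < length (\<rho> p) \<Longrightarrow> \<rho> p ! i \<noteq> a"
  shows "((mat 1 - chain_edges P \<rho>) *v w) $ a = w $ a"
proof -
  have "chain_edges P \<rho> $ a $ b = 0" for b
    using assms unfolding chain_edges_def by auto
  then have "(chain_edges P \<rho> *v w) $ a = 0"
    by (simp add: matrix_vector_mult_def)
  then show ?thesis by (simp add: matrix_vector_mult_diff_rdistrib)
qed

lemma chain_edges_last:
  assumes "p \<in> P"
  shows "((mat 1 - chain_edges P \<rho>) *v w) $ p = w $ p"
proof (rule chain_edges_off)
  fix q i assume q: "q \<in> P" "Suc i < length (\<rho> q)"
  show "\<rho> q ! i \<noteq> p"
    using chain_index_unique[OF q(1) _ assms, of i "length (\<rho> p) - 1"] q(2)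
      chain_last[OF assms] chain_nonempty[OF assms] by auto
qed

text \<open>Along a chain the equation (I - Lambda) w = 0 says that neighbouring entries of w agree.
  The induction runs backwards from the last node, which is \<open>p\<close>.\<close>

lemma chain_edges_constant:
  assumes "p \<in> P" "i < length (\<rho> p)"
    and "\<And>i. Suc i < length (\<rho> p) \<Longrightarrow> ((mat 1 - chain_edges P \<rho>) *v w) $ (\<rho> p ! i) = 0"
  shows "w $ (\<rho> p ! i) = w $ p"
proof -
  have "i \<le> length (\<rho> p) - 1" using assms(2) by simp
  then show ?thesis
  proof (induction rule: inc_induct)
    case base
    then show ?case using chain_last[OF assms(1)] by simp
  next
    case (step n)
    then have "Suc n < length (\<rho> p)" by simp
    then show ?case using step chain_edges_step[OF assms(1), of n w] assms(3)[of n] by simp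
  qed
qed

text \<open>A kernel vector is constant along each chain and zero at its end, since the last node of
  a chain has no outgoing chain edge; off the chains the equation is w = 0 outright.\<close>

lemma chain_edges_invertible: "invertible (mat 1 - chain_edges P \<rho>)"
  unfolding invertible_left_inverse matrix_left_invertible_ker
proof (intro allI impI)
  fix w assume 0: "(mat 1 - chain_edges P \<rho>) *v w = 0"
  have "w $ a = 0" for a
  proof (cases "\<exists>p\<in>P. \<exists>i. Suc i < length (\<rho> p) \<and> \<rho> p ! i = a")
    case True
    then obtain p i where p: "p \<in> P" "Suc i < length (\<rho> p)" "\<rho> p ! i = a" by blast
    then have "w $ a = w $ p" using chain_edges_constant[of p i w] 0 by simp
    also have "\<dots> = 0" using chain_edges_last[OF p(1), of w] 0 by simp
    finally show ?thesis .
  next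
    case False
    then show ?thesis using chain_edges_off[of a w] 0 by auto
  qed
  then show "w = 0" by (simp add: vec_eq_iff)
qed

text \<open>The inverse counts directed paths, and from the head of the chain of \<open>p\<close>
  the only end of a chain that can be reached is \<open>p\<close> itself, in one way. The proof
  reads this off the linear equation for column \<open>q\<close>.\<close>

lemma chain_edges_inverse:
  assumes "p \<in> P" "q \<in> P"
  shows "matrix_inv (mat 1 - chain_edges P \<rho>) $ hd (\<rho> p) $ q = (if p = q then 1 else 0)"
proof -
  define w where "w = column q (matrix_inv (mat 1 - chain_edges P \<rho>))"
  have "(mat 1 - chain_edges P \<rho>) *v w = column q ((mat 1 - chain_edges P \<rho>) ** matrix_inv (mat 1 - chain_edges P \<rho>))"
    unfolding w_def by (simp add: vec_eq_iff column_def matrix_matrix_mult_def matrix_vector_mult_def)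
  then have u: "((mat 1 - chain_edges P \<rho>) *v w) $ a = (if a = q then 1 else 0)" for a
    using matrix_inv_inverse(1)[OF chain_edges_invertible] by (simp add: column_def mat_def)
  have "w $ (\<rho> p ! 0) = w $ p"
  proof (rule chain_edges_constant[OF assms(1)])
    show "0 < length (\<rho> p)" using chain_nonempty[OF assms(1)] by simp
    fix i assume i: "Suc i < length (\<rho> p)"
    \<comment> \<open>\<open>q\<close> occurs only as the last entry of its own chain, and
      \<open>Suc i < length (\<rho> p)\<close> keeps \<open>i\<close> before the last
      position.\<close>
    have "\<rho> p ! i \<noteq> q"
      using chain_index_unique[OF assms(1) _ assms(2), of i "length (\<rho> q) - 1"] i
        chain_last[OF assms(2)] chain_nonempty[OF assms(2)] by auto
    then show "((mat 1 - chain_edges P \<rho>) *v w) $ (\<rho> p ! i) = 0" using u by simp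
  qed
  also have "\<dots> = (if p = q then 1 else 0)" using chain_edges_last[OF assms(1), of w] u by simp
  finally show ?thesis using chain_nonempty[OF assms(1)] by (simp add: w_def column_def hd_conv_nth)
qed

lemma chain_edges_zero: "(a, b) \<notin> D \<Longrightarrow> chain_edges P \<rho> $ a $ b = 0"
  using dc by (auto simp: chain_edges_def disjoint_chains_def directed_chain_def)

end

section \<open>Identities for the parametrization\<close>

lemma matrix_diff_ldistrib:
  fixes A :: "real^'n^'m"
  shows "A ** (B - C) = A ** B - A ** C"
  by (simp add: vec_eq_iff matrix_matrix_mult_def sum_subtractf algebra_simps)

lemma phi_alt:
  "phi \<theta> = transpose (matrix_inv (mat 1 - fst \<theta>)) ** snd \<theta> ** matrix_inv (mat 1 - fst \<theta>)"
  by (simp add: phi_def split: prod.split)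

lemma transpose_mult_phi:
  assumes "invertible (mat 1 - fst \<theta>)"
  shows "transpose (mat 1 - fst \<theta>) ** phi \<theta> = snd \<theta> ** matrix_inv (mat 1 - fst \<theta>)"
proof -
  have "transpose (mat 1 - fst \<theta>) ** transpose (matrix_inv (mat 1 - fst \<theta>)) = mat 1"
    using matrix_inv_inverse(2)[OF assms] by (metis matrix_transpose_mul transpose_mat)
  then show ?thesis by (simp add: phi_alt matrix_mul_assoc)
qed

lemma phi_mult:
  assumes "invertible (mat 1 - fst \<theta>)"
  shows "phi \<theta> ** (mat 1 - fst \<theta>) = transpose (matrix_inv (mat 1 - fst \<theta>)) ** snd \<theta>"
  using matrix_inv_inverse(2)[OF assms] by (simp add: phi_alt flip: matrix_mul_assoc)

lemma phi_congruence:
  assumes "invertible (mat 1 - fst \<theta>)"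
  shows "transpose (mat 1 - fst \<theta>) ** phi \<theta> ** (mat 1 - fst \<theta>) = snd \<theta>"
  using matrix_inv_inverse(2)[OF assms]
  by (simp add: transpose_mult_phi[OF assms] flip: matrix_mul_assoc)

lemma rational_matrix_on_phi:
  assumes "rational_matrix_on c S L" "rational_matrix_on c S W" "\<And>s. s \<in> S \<Longrightarrow> det (mat 1 - L s) \<noteq> 0"
  shows "rational_matrix_on c S (\<lambda>s. phi (L s, W s))"
  unfolding phi_alt fst_conv snd_conv
  by (intro rational_matrix_on_mult rational_matrix_on_transpose rational_matrix_on_inv
      rational_matrix_on_diff rational_matrix_on_const assms)

text \<open>Omega is taken of the form C C^T with one column per parent, so that the determinant
  factors; the two factors are nonzero at the two ends of a pencil of parameters.\<close>
lemma htc_rows_det_nonzero: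
  fixes D B :: "('n::finite \<times> 'n) set"
  assumes "sym B" "disjoint_chains D P \<rho>" "inj_on \<sigma> P"
    and \<sigma>: "\<And>p. p \<in> P \<Longrightarrow> \<sigma> p = hd (\<rho> p) \<or> (\<sigma> p, hd (\<rho> p)) \<in> B"
  shows "\<exists>\<theta>\<in>regular_pairs D B. det (pad P (htc_rows D B v \<sigma> \<theta>)) \<noteq> 0"
proof -
  \<comment> \<open>One real variable, seen as a coordinate vector over the unit type, so that
    \<open>polyfun\<close> and \<open>rational_on\<close> apply along the pencil.\<close>
  define c where "c = (\<lambda>(s::real) (_::unit). s)"
  define \<Lambda> where "\<Lambda> s = s *\<^sub>R chain_edges P \<rho>" for s
  \<comment> \<open>Column p moves from the unit vector at \<open>\<sigma> p\<close> (s = 0) to the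
    one at the head of its chain (s = 1). These nodes are equal or joined by a bidirected edge, so C
    C^T has the zero pattern prescribed by \<open>B\<close>.\<close>
  define C :: "real \<Rightarrow> real^'n^'n" where "C s = (\<chi> k p. if p \<in> P then
    (1 - s) * (if k = \<sigma> p then 1 else 0) + s * (if k = hd (\<rho> p) then 1 else 0) else 0)" for s
  define S where "S = {s. det (mat 1 - \<Lambda> s) \<noteq> 0}"
  define N where "N s = matrix_inv (mat 1 - \<Lambda> s)" for s
  \<comment> \<open>The left factor for which \<open>htc_rows\<close> equals M Omega N: a unit row
    selects from Omega N = (I - Lambda)^T Sigma, a row of N^T selects from N^T Omega N =
    Sigma.\<close>
  define M :: "real \<Rightarrow> real^'n^'n" where
    "M s = (\<chi> x k. if \<sigma> x \<in> htr D B v then (if k = \<sigma> x then 1 else 0) else N s $ k $ \<sigma> x)" for s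
  define \<theta> where "\<theta> s = (\<Lambda> s, C s ** transpose (C s))" for s
  have rc: "rational_on c T (\<lambda>s. s)" for T using rational_on_coord[of c T "()"] by (simp add: c_def)
  have r\<Lambda>: "rational_matrix_on c T \<Lambda>" for T
    unfolding rational_matrix_on_def \<Lambda>_def
    by (simp add: rational_on_mult rational_on_const rc)
  have rN: "rational_matrix_on c S N"
    unfolding N_def
    by (intro rational_matrix_on_inv rational_matrix_on_diff rational_matrix_on_const r\<Lambda>)
       (simp add: S_def)
  have rC: "rational_matrix_on c S C"
    unfolding rational_matrix_on_def
  proof (intro allI)
    fix i j
    show "rational_on c S (\<lambda>s. C s $ i $ j)"
      by (cases "j \<in> P") (auto simp: C_def intro!: rational_on_add rational_on_mult rational_on_diff
          rational_on_const rc)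
  qed
  have rM: "rational_matrix_on c S M"
    unfolding rational_matrix_on_def
  proof (intro allI)
    fix i j
    show "rational_on c S (\<lambda>s. M s $ i $ j)"
      using rN by (cases "\<sigma> i \<in> htr D B v") (auto simp: M_def rational_matrix_on_def intro: rational_on_const)
  qed
  have "rational_on c S (\<lambda>s. det (pad P (M s ** C s)))"
    by (intro rational_on_det rational_matrix_on_pad rational_matrix_on_mult rM rC)
  then obtain p1 where p1: "polyfun p1" "\<And>s. s \<in> S \<Longrightarrow> p1 (c s) = 0 \<longleftrightarrow> det (pad P (M s ** C s)) = 0"
    by (rule rational_on_zeros) blast
  have "rational_on c S (\<lambda>s. det (pad P (transpose (C s) ** N s)))"
    by (intro rational_on_det rational_matrix_on_pad rational_matrix_on_mult rational_matrix_on_transpose rN rC)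
  then obtain p2 where p2: "polyfun p2"
      "\<And>s. s \<in> S \<Longrightarrow> p2 (c s) = 0 \<longleftrightarrow> det (pad P (transpose (C s) ** N s)) = 0"
    by (rule rational_on_zeros) blast
  have "rational_on c UNIV (\<lambda>s. det (mat 1 - \<Lambda> s))"
    by (intro rational_on_det rational_matrix_on_diff rational_matrix_on_const r\<Lambda>)
  then obtain p0 where p0: "polyfun p0" "\<And>s. p0 (c s) = 0 \<longleftrightarrow> det (mat 1 - \<Lambda> s) = 0"
    by (rule rational_on_zeros) blast
  have S0: "0 \<in> S" by (simp add: S_def \<Lambda>_def)
  have S1: "1 \<in> S"
    using chain_edges_invertible[OF assms(2)] by (simp add: S_def \<Lambda>_def invertible_det_nz)
  have N0: "N 0 = mat 1"
    using matrix_inv_inverse(1)[of "mat 1 :: real^'n^'n"] by (simp add: N_def \<Lambda>_def invertible_det_nz)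
  have M0: "M 0 $ x $ k = (if k = \<sigma> x then 1 else 0)" for x k
    by (simp add: M_def N0 mat_def)
  \<comment> \<open>At s = 0 there are no directed edges, both kinds of rows of M are unit vectors
    at \<open>\<sigma> x\<close>, and injectivity of \<open>\<sigma>\<close> gives the identity
    block.\<close>
  have "pad P (M 0 ** C 0) = mat 1"
  proof (rule pad_eq_mat_1)
    fix x z assume xz: "x \<in> P" "z \<in> P"
    have "M 0 $ x $ k * C 0 $ k $ z = (if k = \<sigma> x then C 0 $ \<sigma> x $ z else 0)" for k
      by (simp add: M0)
    then have "(M 0 ** C 0) $ x $ z = C 0 $ \<sigma> x $ z" by (simp add: matrix_matrix_mult_def)
    then show "(M 0 ** C 0) $ x $ z = (if x = z then 1 else 0)"
      using xz assms(3) by (simp add: C_def inj_on_eq_iff)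
  qed
  then have n1: "p1 (c 0) \<noteq> 0" using p1(2)[OF S0] by simp
  \<comment> \<open>At s = 1 the rows of C^T are unit vectors at the heads of the chains, where
    \<open>chain_edges_inverse\<close> gives the identity block.\<close>
  have "pad P (transpose (C 1) ** N 1) = mat 1"
  proof (rule pad_eq_mat_1)
    fix x z assume xz: "x \<in> P" "z \<in> P"
    have "transpose (C 1) $ x $ k * N 1 $ k $ z = (if k = hd (\<rho> x) then N 1 $ k $ z else 0)" for k
      using xz by (simp add: transpose_def C_def)
    then have "(transpose (C 1) ** N 1) $ x $ z = N 1 $ hd (\<rho> x) $ z"
      by (simp add: matrix_matrix_mult_def)
    then show "(transpose (C 1) ** N 1) $ x $ z = (if x = z then 1 else 0)"
      using chain_edges_inverse[OF assms(2) xz] by (simp add: N_def \<Lambda>_def)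
  qed
  then have n2: "p2 (c 1) \<noteq> 0" using p2(2)[OF S1] by simp
  have n0: "p0 (c 0) \<noteq> 0" using p0(2)[of 0] S0 by (simp add: S_def)
  have c: "c s = (\<lambda>i. 0 + s * 1)" for s by (simp add: c_def)
  have fin: "finite {s. p (c s) = 0}" if "polyfun p" "p (c t) \<noteq> 0" for p t
    using polyfun_finite_roots_on_line[OF that(1), of "\<lambda>_. 0" t "\<lambda>_. 1"] that(2) unfolding c by blast
  have "finite ({s. p0 (c s) = 0} \<union> {s. p1 (c s) = 0} \<union> {s. p2 (c s) = 0})"
    using fin p0(1) p1(1) p2(1) n0 n1 n2 by blast
  from ex_new_if_finite[OF infinite_UNIV_char_0 this]
  obtain s where s: "p0 (c s) \<noteq> 0" "p1 (c s) \<noteq> 0" "p2 (c s) \<noteq> 0" by auto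
  have sS: "s \<in> S" using s(1) p0(2) by (simp add: S_def)
  have inv: "invertible (mat 1 - fst (\<theta> s))"
    using sS by (simp add: S_def \<theta>_def invertible_det_nz)
  have rows: "htc_rows D B v \<sigma> (\<theta> s) = (M s ** C s) ** (transpose (C s) ** N s)"
  proof -
    have MX: "(M s ** X) $ x $ z = (if \<sigma> x \<in> htr D B v then X $ \<sigma> x $ z else (transpose (N s) ** X) $ \<sigma> x $ z)"
      for X :: "real^'n^'n" and x z
    proof -
      have "M s $ x $ k * X $ k $ z = (if \<sigma> x \<in> htr D B v then if k = \<sigma> x then X $ k $ z else 0
          else transpose (N s) $ \<sigma> x $ k * X $ k $ z)" for k by (simp add: M_def transpose_def)
      then show ?thesis by (simp add: matrix_matrix_mult_def)
    qed
    have "(M s ** (snd (\<theta> s) ** N s)) $ x $ z = htc_rows D B v \<sigma> (\<theta> s) $ x $ z" for x z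
      unfolding htc_rows_def transpose_mult_phi[OF inv] MX
      by (simp add: phi_alt \<theta>_def N_def matrix_mul_assoc)
    then have "M s ** (snd (\<theta> s) ** N s) = htc_rows D B v \<sigma> (\<theta> s)" by (simp add: vec_eq_iff)
    then show ?thesis by (simp add: \<theta>_def matrix_mul_assoc)
  qed
  have "pad P (M s ** C s) ** pad P (transpose (C s) ** N s) = pad P (htc_rows D B v \<sigma> (\<theta> s))"
    unfolding rows by (rule pad_mult) (simp add: matrix_matrix_mult_def C_def)
  then have "det (pad P (htc_rows D B v \<sigma> (\<theta> s))) = det (pad P (M s ** C s)) * det (pad P (transpose (C s) ** N s))"
    by (metis det_mul)
  then have "det (pad P (htc_rows D B v \<sigma> (\<theta> s))) \<noteq> 0" using s p1(2)[OF sS] p2(2)[OF sS] by simp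
  moreover have "\<theta> s \<in> regular_pairs D B"
  proof -
    have "(C s ** transpose (C s)) $ a $ b = 0" if "a \<noteq> b" "(a, b) \<notin> B" for a b
    proof -
      have "C s $ a $ k * C s $ b $ k = 0" for k
        using \<sigma>[of k] that assms(1) by (auto simp: C_def sym_def)
      then show ?thesis
        by (auto simp: matrix_matrix_mult_def transpose_def intro!: sum.neutral)
    qed
    moreover have "transpose (C s ** transpose (C s)) = C s ** transpose (C s)"
      by (simp add: matrix_transpose_mul)
    ultimately show ?thesis
      using inv chain_edges_zero[OF assms(2)] by (auto simp: regular_pairs_def \<theta>_def RDreg_def \<Lambda>_def)
  qed
  ultimately show ?thesis by blast
qed

subsection \<open>Rational identifiability\<close>

text \<open>The Neumann series may diverge, so an invariant subspace replaces it. (I - Lambda)^T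
  maps the vectors supported on nodes reachable from \<open>x\<close> injectively into themselves,
  hence onto by dimension. The preimage of the unit vector at \<open>x\<close> is row
  \<open>x\<close> of the inverse, so that row has the same support.\<close>

lemma matrix_inv_nonzero_imp_reachable:
  fixes D :: "('n::finite \<times> 'n) set"
  assumes "\<Lambda> \<in> RDreg D" "matrix_inv (mat 1 - \<Lambda>) $ x $ y \<noteq> 0"
  shows "(x, y) \<in> D\<^sup>*"
proof (rule ccontr)
  assume ny: "(x, y) \<notin> D\<^sup>*"
  have inv: "invertible (mat 1 - \<Lambda>)" and z: "\<And>v w. (v, w) \<notin> D \<Longrightarrow> \<Lambda> $ v $ w = 0"
    using assms(1) by (auto simp: RDreg_def)
  define S where "S = {w :: real^'n. \<forall>j. (x, j) \<notin> D\<^sup>* \<longrightarrow> w $ j = 0}"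
  define T where "T = (*v) (transpose (mat 1 - \<Lambda>))"
  have TN: "transpose (matrix_inv (mat 1 - \<Lambda>)) *v T w = w" for w
    using matrix_inv_inverse(1)[OF inv]
    by (metis T_def matrix_transpose_mul matrix_vector_mul_assoc matrix_vector_mul_lid transpose_mat)
  have sub: "subspace S" by (auto simp: S_def subspace_def)
  have lin: "linear T" by (simp add: T_def)
  have inj: "inj T" using TN by (metis injI)
  have "T ` S \<subseteq> S"
  proof
    fix u assume "u \<in> T ` S"
    then obtain w where w: "w \<in> S" "u = T w" by blast
    have "u $ j = 0" if j: "(x, j) \<notin> D\<^sup>*" for j
    proof -
      have "(mat 1 - \<Lambda>) $ i $ j * w $ i = 0" for i
      proof (cases "(x, i) \<in> D\<^sup>*")
        case True
        then have "(i, j) \<notin> D" "i \<noteq> j" using j by (auto dest: rtrancl_into_rtrancl)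
        then show ?thesis using z by (simp add: mat_def)
      next
        case False
        then show ?thesis using w(1) by (simp add: S_def)
      qed
      then show ?thesis unfolding w(2) T_def
        by (auto simp: matrix_vector_mult_def transpose_def intro!: sum.neutral)
    qed
    then show "u \<in> S" by (simp add: S_def)
  qed
  moreover have "dim (T ` S) = dim S"
    using dim_image_eq[OF lin, of S] inj by (simp add: inj_on_subset)
  ultimately have "T ` S = S"
    using subspace_dim_equal[OF linear_subspace_image[OF lin sub] sub] by simp
  moreover have "axis x 1 \<in> S" by (auto simp: S_def axis_def)
  ultimately obtain w where w: "w \<in> S" "T w = axis x 1" by (metis imageE)
  have "w = transpose (matrix_inv (mat 1 - \<Lambda>)) *v axis x 1" using TN[of w] w(2) by simp
  then have "w $ y = matrix_inv (mat 1 - \<Lambda>) $ x $ y"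
    by (simp add: matrix_vector_mult_basis column_def transpose_def)
  then show False using w(1) ny assms(2) by (simp add: S_def)
qed

text \<open>Sigma (I - Lambda) equals N^T Omega with N the inverse of I - Lambda. A nonzero term at
  (y, v) has a node x equal to v or joined to it by a bidirected edge, and a directed path from x to
  y: together a half-trek from v to y.\<close>

lemma phi_mult_nonhtr:
  assumes "sym B" "\<theta> \<in> regular_pairs D B" "y \<notin> {v} \<union> sib B v \<union> htr D B v"
  shows "(phi \<theta> ** (mat 1 - fst \<theta>)) $ y $ v = 0"
proof -
  have \<theta>: "fst \<theta> \<in> RDreg D" "\<And>v w. v \<noteq> w \<Longrightarrow> (v, w) \<notin> B \<Longrightarrow> snd \<theta> $ v $ w = 0"
    using assms(2) by (auto simp: regular_pairs_def)
  have "matrix_inv (mat 1 - fst \<theta>) $ x $ y * snd \<theta> $ x $ v = 0" for x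
  proof (rule ccontr)
    assume "\<not> ?thesis"
    then have nz: "matrix_inv (mat 1 - fst \<theta>) $ x $ y \<noteq> 0" "snd \<theta> $ x $ v \<noteq> 0" by auto
    obtain xs where xs: "directed_chain D xs" "hd xs = x" "last xs = y"
      using rtrancl_imp_directed_chain[OF matrix_inv_nonzero_imp_reachable[OF \<theta>(1) nz(1)]] by blast
    moreover have "v = x \<or> (v, x) \<in> B" using \<theta>(2)[of x v] nz(2) assms(1) by (auto simp: sym_def)
    ultimately have "y \<in> htr D B v" unfolding mem_htr_iff using assms(3) by auto
    then show False using assms(3) by simp
  qed
  then have "(transpose (matrix_inv (mat 1 - fst \<theta>)) ** snd \<theta>) $ y $ v = 0"
    by (auto simp: matrix_matrix_mult_def transpose_def intro!: sum.neutral)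
  then show ?thesis
    using invertible_regular_pairs[OF assms(2)] by (simp add: phi_mult invertible_det_nz)
qed

text \<open>In both cases the chosen matrix X satisfies (X (I - Lambda)) = 0 at
  (\<open>\<sigma> x\<close>, v), either because \<open>\<sigma> x\<close> is not a sibling of v or
  by \<open>phi_mult_nonhtr\<close>. The identity rows of \<open>pad\<close> state that column v of
  Lambda vanishes outside the parents.\<close>

lemma htc_rows_solution:
  fixes D B :: "('n::finite \<times> 'n) set"
  assumes "sym B" "\<theta> \<in> regular_pairs D B" "HTC D B Y v" "\<sigma> ` pa D v \<subseteq> Y"
  shows "pad (pa D v) (htc_rows D B v \<sigma> \<theta>) *v column v (fst \<theta>) =
    (\<chi> x. if x \<in> pa D v then htc_rows D B v \<sigma> \<theta> $ x $ v else 0)"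
proof -
  have inv: "invertible (mat 1 - fst \<theta>)"
    using invertible_regular_pairs[OF assms(2)] by (simp add: invertible_det_nz)
  have zero: "fst \<theta> $ z $ v = 0" if "z \<notin> pa D v" for z
    using assms(2) that by (auto simp: regular_pairs_def RDreg_def pa_def)
  have "(pad (pa D v) (htc_rows D B v \<sigma> \<theta>) *v column v (fst \<theta>)) $ x =
        (if x \<in> pa D v then htc_rows D B v \<sigma> \<theta> $ x $ v else 0)" for x
  proof (cases "x \<in> pa D v")
    case True
    define X where "X = (if \<sigma> x \<in> htr D B v then transpose (mat 1 - fst \<theta>) ** phi \<theta> else phi \<theta>)"
    have y: "\<sigma> x \<notin> {v} \<union> sib B v" using assms(3,4) True by (auto simp: HTC_def)
    have "(X ** (mat 1 - fst \<theta>)) $ \<sigma> x $ v = 0"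
    proof (cases "\<sigma> x \<in> htr D B v")
      case True
      then have "X ** (mat 1 - fst \<theta>) = snd \<theta>" using phi_congruence[OF inv] by (simp add: X_def)
      moreover have "snd \<theta> $ \<sigma> x $ v = 0"
        using assms(2) y by (auto simp: regular_pairs_def sib_def)
      ultimately show ?thesis by simp
    next
      case False
      then show ?thesis using phi_mult_nonhtr[OF assms(1,2), of "\<sigma> x" v] y by (simp add: X_def)
    qed
    then have "X $ \<sigma> x $ v = (X ** fst \<theta>) $ \<sigma> x $ v" by (simp add: matrix_diff_ldistrib)
    moreover have rows: "htc_rows D B v \<sigma> \<theta> $ x $ z = X $ \<sigma> x $ z" for z
      by (simp add: htc_rows_def X_def)
    moreover have "pad (pa D v) (htc_rows D B v \<sigma> \<theta>) $ x $ z * fst \<theta> $ z $ v = X $ \<sigma> x $ z * fst \<theta> $ z $ v" for z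
      using True zero rows by (cases "z \<in> pa D v") (simp_all add: pad_def)
    then have "(\<Sum>z\<in>UNIV. pad (pa D v) (htc_rows D B v \<sigma> \<theta>) $ x $ z * fst \<theta> $ z $ v) =
        (\<Sum>z\<in>UNIV. X $ \<sigma> x $ z * fst \<theta> $ z $ v)" by (intro sum.cong) auto
    ultimately show ?thesis using True
      by (simp add: matrix_vector_mult_def column_def matrix_matrix_mult_def)
  next
    case False
    then have "pad (pa D v) (htc_rows D B v \<sigma> \<theta>) $ x $ z * fst \<theta> $ z $ v = 0" for z
      using zero by (auto simp: pad_def)
    then show ?thesis using False
      by (auto simp: matrix_vector_mult_def column_def intro!: sum.neutral)
  qed
  then show ?thesis by (simp add: vec_eq_iff)
qed

theorem HTC_identifiable_imp_rationally_identifiable: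
  fixes D B :: "('n::finite \<times> 'n) set"
  assumes "sym B" "HTC_identifiable D B"
  shows "rationally_identifiable D B"
proof -
  obtain Y r where Y: "\<And>v. HTC D B (Y v) v" and r: "strict_linear_order r"
    and Yr: "\<And>v w. w \<in> Y v \<Longrightarrow> w \<in> htr D B v \<Longrightarrow> (w, v) \<in> r"
    using assms(2) unfolding HTC_identifiable_def by blast
  have "\<exists>\<sigma>. \<sigma> ` pa D v \<subseteq> Y v \<and>
      (\<exists>\<theta>\<in>regular_pairs D B. det (pad (pa D v) (htc_rows D B v \<sigma> \<theta>)) \<noteq> 0)" for v
  proof -
    obtain \<sigma> \<rho> where "bij_betw \<sigma> (pa D v) (Y v)" "disjoint_chains D (pa D v) \<rho>"
      "\<And>p. p \<in> pa D v \<Longrightarrow> \<sigma> p = hd (\<rho> p) \<or> (\<sigma> p, hd (\<rho> p)) \<in> B"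
      by (rule HTC_imp_disjoint_chains[OF Y[of v]]) blast
    then show ?thesis
      using htc_rows_det_nonzero[OF assms(1), of D "pa D v" \<rho> \<sigma> v]
      by (intro exI[of _ \<sigma>]) (auto simp: bij_betw_def)
  qed
  then obtain \<sigma> where \<sigma>: "\<And>v. \<sigma> v ` pa D v \<subseteq> Y v"
    "\<And>v. \<exists>\<theta>\<in>regular_pairs D B. det (pad (pa D v) (htc_rows D B v (\<sigma> v) \<theta>)) \<noteq> 0" by metis
  define A where "A v \<theta> = pad (pa D v) (htc_rows D B v (\<sigma> v) \<theta>)" for v \<theta>
  have "\<exists>Q. polyfun Q \<and> (\<forall>\<theta>\<in>regular_pairs D B. Q (theta_coords \<theta>) = 0 \<longleftrightarrow> det (A v \<theta>) = 0)" for v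
  proof -
    have \<phi>: "rational_matrix_on theta_coords (regular_pairs D B) phi"
      using rational_matrix_on_phi[OF rational_matrix_on_theta, of "regular_pairs D B"]
        invertible_regular_pairs[of _ D B] by simp
    then have \<phi>': "rational_matrix_on theta_coords (regular_pairs D B) (\<lambda>\<theta>. transpose (mat 1 - fst \<theta>) ** phi \<theta>)"
      by (intro rational_matrix_on_mult rational_matrix_on_transpose rational_matrix_on_diff
          rational_matrix_on_const rational_matrix_on_theta)
    have "rational_on theta_coords (regular_pairs D B) (\<lambda>\<theta>. htc_rows D B v (\<sigma> v) \<theta> $ i $ j)" for i j
      using \<phi> \<phi>' by (cases "\<sigma> v i \<in> htr D B v") (simp_all add: htc_rows_def rational_matrix_on_def)
    then have "rational_on theta_coords (regular_pairs D B) (\<lambda>\<theta>. det (A v \<theta>))"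
      unfolding A_def by (intro rational_on_det rational_matrix_on_pad) (simp add: rational_matrix_on_def)
    then show ?thesis by (rule rational_on_zeros) blast
  qed
  then obtain Q where Q: "\<And>v. polyfun (Q v)"
    "\<And>v \<theta>. \<theta> \<in> regular_pairs D B \<Longrightarrow> Q v (theta_coords \<theta>) = 0 \<longleftrightarrow> det (A v \<theta>) = 0" by metis
  \<comment> \<open>One polynomial for all nodes, so that outside a single proper subset every
    system is solvable.\<close>
  define f where "f x = (\<Prod>v\<in>UNIV. Q v x)" for x
  have f: "polyfun f" unfolding f_def by (rule polyfun_prod) (rule Q)
  have "\<exists>\<theta>\<in>regular_pairs D B. f (theta_coords \<theta>) \<noteq> 0"
    unfolding f_def
  proof (rule nonzero_polyfun_prod)
    fix v
    show "\<exists>\<theta>\<in>regular_pairs D B. Q v (theta_coords \<theta>) \<noteq> 0"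
      using \<sigma>(2)[of v] Q(2) by (auto simp: A_def)
  qed (use Q in auto)
  then obtain \<theta>0 where \<theta>0: "\<theta>0 \<in> regular_pairs D B" "f (theta_coords \<theta>0) \<noteq> 0" by blast
  define W where "W = {\<theta> \<in> Theta D B. f (theta_coords \<theta>) = 0}"
  have W: "proper_algebraic_subset D B W"
    unfolding W_def by (rule proper_algebraic_subset_zeros[OF f \<theta>0])
  define S where "S = Theta D B - W"
  have S: "\<theta> \<in> regular_pairs D B" "det (A v \<theta>) \<noteq> 0" if "\<theta> \<in> S" for \<theta> v
  proof -
    have "\<theta> \<in> Theta D B" "f (theta_coords \<theta>) \<noteq> 0" using that by (auto simp: S_def W_def)
    then show *: "\<theta> \<in> regular_pairs D B" using Theta_subset_regular_pairs by blast
    show "det (A v \<theta>) \<noteq> 0"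
      using \<open>f (theta_coords \<theta>) \<noteq> 0\<close> Q(2)[OF *] by (simp add: f_def)
  qed
  \<comment> \<open>From here on the coordinates are the entries of Sigma; the parameter coordinates
    above served only to find \<open>W\<close>.\<close>
  define c where "c = (\<lambda>\<theta>. mat_coords (phi \<theta> :: real^'n^'n))"
  have "rational_on c S (\<lambda>\<theta>. phi \<theta> $ i $ j)" for i j
    using rational_on_coord[of c S "(i, j)"] by (simp add: c_def mat_coords_def)
  then have c\<phi>: "rational_matrix_on c S phi" by (simp add: rational_matrix_on_def)
  have "wf r"
  proof (rule finite_acyclic_wf)
    show "acyclic r" using r by (simp add: strict_linear_order_on_def acyclic_irrefl)
  qed simp
  then have \<Lambda>: "\<forall>x. rational_on c S (\<lambda>\<theta>. fst \<theta> $ x $ v)" for v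
  proof (induction v rule: wf_induct_rule)
    case (less v)
    have rows: "rational_on c S (\<lambda>\<theta>. htc_rows D B v (\<sigma> v) \<theta> $ x $ z)" if "x \<in> pa D v" for x z
    proof (cases "\<sigma> v x \<in> htr D B v")
      case True
      \<comment> \<open>This row of (I - Lambda)^T Sigma uses only column
        \<open>\<sigma> v x\<close> of Lambda, which is smaller in \<open>r\<close> and so already
        rational in Sigma.\<close>
      then have "(\<sigma> v x, v) \<in> r" using Yr \<sigma>(1) that by blast
      then have "rational_on c S (\<lambda>\<theta>. (mat 1 - fst \<theta>) $ k $ \<sigma> v x)" for k
        using less.IH by (auto intro: rational_on_diff rational_on_const)
      then show ?thesis using True c\<phi>
        by (auto simp: htc_rows_def matrix_matrix_mult_def transpose_def rational_matrix_on_def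
            intro!: rational_on_sum rational_on_mult)
    next
      case False
      then show ?thesis using c\<phi> by (simp add: htc_rows_def rational_matrix_on_def)
    qed
    have "rational_on c S (\<lambda>\<theta>. A v \<theta> $ x $ z)" for x z
      using rows by (cases "x \<in> pa D v \<and> z \<in> pa D v") (auto simp: A_def pad_def intro: rational_on_const)
    then have A: "rational_matrix_on c S (A v)" by (simp add: rational_matrix_on_def)
    have b: "rational_on c S (\<lambda>\<theta>. (\<chi> x. if x \<in> pa D v then htc_rows D B v (\<sigma> v) \<theta> $ x $ v else 0) $ i)" for i
      using rows by (cases "i \<in> pa D v") (auto intro: rational_on_const)
    have "rational_on c S (\<lambda>\<theta>. column v (fst \<theta>) $ x)" for x
      by (rule rational_on_cramer[OF A b S(2)])
         (use htc_rows_solution[OF assms(1) S(1) Y \<sigma>(1)] in \<open>simp_all add: A_def\<close>)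
    then show ?case by (simp add: column_def)
  qed
  then have c\<Lambda>: "rational_matrix_on c S fst" by (simp add: rational_matrix_on_def)
  have "rational_matrix_on c S (\<lambda>\<theta>. transpose (mat 1 - fst \<theta>) ** phi \<theta> ** (mat 1 - fst \<theta>))"
    by (intro rational_matrix_on_mult rational_matrix_on_transpose rational_matrix_on_diff
        rational_matrix_on_const c\<Lambda> c\<phi>)
  moreover have "transpose (mat 1 - fst \<theta>) ** phi \<theta> ** (mat 1 - fst \<theta>) = snd \<theta>" if "\<theta> \<in> S" for \<theta>
    using invertible_regular_pairs[OF S(1)[OF that]] by (intro phi_congruence) (simp add: invertible_det_nz)
  ultimately have c\<Omega>: "rational_matrix_on c S snd"
    unfolding rational_matrix_on_def using rational_on_cong[of S _ _ c] by (smt (verit, best))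
  have "rational_on c S (\<lambda>\<theta>. theta_coords \<theta> k)" for k
    using c\<Lambda> c\<Omega> by (cases k) (auto simp: theta_coords_def rational_matrix_on_def split: prod.split)
  then obtain p q where "\<And>k. polyfun (p k)" "\<And>k. polyfun (q k)"
    "\<And>k s. s \<in> S \<Longrightarrow> q k (c s) \<noteq> 0 \<and> theta_coords s k = p k (c s) / q k (c s)"
    unfolding rational_on_def by metis
  then show ?thesis
    unfolding rationally_identifiable_def using W
    by (intro exI[of _ W] exI[of _ p] exI[of _ q]) (simp add: S_def c_def)
qed

subsection \<open>Matchings from linear independence\<close>

text \<open>Coefficients are attached to indices rather than vectors, since the family
  \<open>k\<close> may take a value twice.\<close>

lemma span_image_imp_sum:
  fixes k :: "'c \<Rightarrow> 'a::real_vector"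
  assumes "finite C" "y \<in> span (k ` C)"
  shows "\<exists>a. y = (\<Sum>c\<in>C. a c *\<^sub>R k c)"
proof -
  define F where "F a = (\<Sum>c\<in>C. a c *\<^sub>R k c)" for a
  have "k ` C \<subseteq> range F"
  proof
    fix x assume "x \<in> k ` C"
    then obtain c where c: "c \<in> C" "x = k c" by blast
    then have "x = F (\<lambda>d. if d = c then 1 else 0)"
      using assms(1) by (simp add: F_def if_distrib[of "\<lambda>u. u *\<^sub>R _"] cong: if_cong)
    then show "x \<in> range F" by blast
  qed
  moreover have "subspace (range F)"
    unfolding subspace_def
  proof (intro conjI ballI allI)
    have "0 = F (\<lambda>c. 0)" by (simp add: F_def)
    then show "0 \<in> range F" by blast
    fix x assume "x \<in> range F"
    then obtain a where a: "x = F a" by blast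
    show "x + y \<in> range F" if "y \<in> range F" for y
    proof -
      obtain b where "y = F b" using \<open>y \<in> range F\<close> by blast
      then have "x + y = F (\<lambda>c. a c + b c)"
        using a by (simp add: F_def scaleR_left_distrib sum.distrib)
      then show ?thesis by blast
    qed
    fix r :: real
    have "r *\<^sub>R x = F (\<lambda>c. r * a c)" using a by (simp add: F_def scaleR_sum_right)
    then show "r *\<^sub>R x \<in> range F" by blast
  qed
  ultimately have "span (k ` C) \<subseteq> range F" by (rule span_minimal)
  then show ?thesis using assms(2) by (auto simp: F_def)
qed

text \<open>A nonzero maximal minor has a nonzero Leibniz term. The induction avoids minors:
  \<open>l\<close>, the component of \<open>k c0\<close> orthogonal to the other vectors, has a
  nonzero product with \<open>k c0\<close> at some row \<open>r\<close>, to which \<open>c0\<close>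
  is matched; the others stay independent after row \<open>r\<close> is cleared.\<close>

lemma independent_imp_matching:
  fixes k :: "'c \<Rightarrow> real^'r::finite"
  assumes "finite C"
    and "\<And>a. (\<Sum>c\<in>C. a c *\<^sub>R k c) = 0 \<Longrightarrow> \<forall>c\<in>C. a c = 0"
  shows "\<exists>m. inj_on m C \<and> (\<forall>c\<in>C. k c $ m c \<noteq> 0)"
  using assms
proof (induction C arbitrary: k rule: finite_induct)
  case (insert c0 C)
  obtain y l where y: "y \<in> span (k ` C)" and l: "\<And>w. w \<in> span (k ` C) \<Longrightarrow> orthogonal l w"
    and dec: "k c0 = y + l" using orthogonal_subspace_decomp_exists by blast
  have "l \<noteq> 0"
  proof
    assume "l = 0"
    then have "k c0 \<in> span (k ` C)" using dec y by simp
    then obtain a where "k c0 = (\<Sum>c\<in>C. a c *\<^sub>R k c)"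
      using span_image_imp_sum[OF insert.hyps(1)] by blast
    moreover have "(\<Sum>c\<in>C. (if c = c0 then -1 else a c) *\<^sub>R k c) = (\<Sum>c\<in>C. a c *\<^sub>R k c)"
      using insert.hyps(2) by (intro sum.cong) auto
    ultimately have "(\<Sum>c\<in>insert c0 C. (if c = c0 then -1 else a c) *\<^sub>R k c) = 0"
      using insert.hyps by simp
    from insert.prems[OF this] show False by simp
  qed
  have "l \<bullet> k c0 = l \<bullet> l" using l[OF y] dec by (simp add: inner_add_right orthogonal_def)
  then have "l \<bullet> k c0 \<noteq> 0" using \<open>l \<noteq> 0\<close> by simp
  then have "(\<Sum>i\<in>UNIV. l $ i * k c0 $ i) \<noteq> 0" by (simp add: inner_vec_def)
  then obtain r where r: "l $ r * k c0 $ r \<noteq> 0" by (meson sum.neutral)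
  define k' where "k' c = k c - (k c $ r) *\<^sub>R axis r 1" for c
  have k'r: "k' c $ r = 0" and k'i: "i \<noteq> r \<Longrightarrow> k' c $ i = k c $ i" for c i
    by (simp_all add: k'_def axis_def)
  have "\<forall>c\<in>C. a c = 0" if a: "(\<Sum>c\<in>C. a c *\<^sub>R k' c) = 0" for a
  proof -
    let ?z = "\<Sum>c\<in>C. a c *\<^sub>R k c"
    have "?z = (\<Sum>c\<in>C. a c *\<^sub>R k' c) + (\<Sum>c\<in>C. a c * k c $ r) *\<^sub>R axis r 1"
      by (simp add: k'_def scaleR_right_diff_distrib sum_subtractf scaleR_sum_left)
    then have z: "?z = (\<Sum>c\<in>C. a c * k c $ r) *\<^sub>R axis r 1" using a by simp
    \<comment> \<open>A relation between the cleared vectors makes \<open>?z\<close> a multiple of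
      the unit vector at \<open>r\<close>. It is also orthogonal to \<open>l\<close>, whose entry at
      \<open>r\<close> is nonzero, so the multiple is zero.\<close>
    have "?z \<in> span (k ` C)" by (intro span_sum span_scale span_base) auto
    then have "l \<bullet> ?z = 0" using l by (simp add: orthogonal_def)
    then have "(\<Sum>c\<in>C. a c * k c $ r) = 0" using r unfolding z by (simp add: inner_axis)
    then have "?z = 0" using z by simp
    moreover have "(\<Sum>c\<in>C. (if c = c0 then 0 else a c) *\<^sub>R k c) = ?z"
      using insert.hyps(2) by (intro sum.cong) auto
    ultimately have "(\<Sum>c\<in>insert c0 C. (if c = c0 then 0 else a c) *\<^sub>R k c) = 0"
      using insert.hyps by simp
    from insert.prems[OF this] show ?thesis using insert.hyps(2) by (metis insertCI)
  qed
  from insert.IH[OF this] obtain m where m: "inj_on m C" "\<And>c. c \<in> C \<Longrightarrow> k' c $ m c \<noteq> 0" by blast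
  have mr: "m c \<noteq> r" if "c \<in> C" for c using m(2)[OF that] k'r by metis
  have "inj_on (m(c0 := r)) (insert c0 C)"
    using m(1) mr insert.hyps(2) by (auto simp: inj_on_def)
  moreover have "\<forall>c\<in>insert c0 C. k c $ (m(c0 := r)) c \<noteq> 0"
    using m(2) mr k'i r by auto
  ultimately show ?case by blast
qed simp

subsection \<open>Half-trek systems from an injective Jacobian\<close>

text \<open>A matching of the columns (v, x) of the enlarged linear system sends (v, x) either to a row
  Inl (v, x'), which is a step backwards along an edge x' -> x, or to a row Inr {y, v}, where a
  half-trek from y can start.\<close>
lemma matching_imp_HTC:
  fixes D B :: "('n::finite \<times> 'n) set" and m :: "'n \<times> 'n \<Rightarrow> ('n \<times> 'n) + 'n set"
  assumes B: "sym B" and inj: "inj m"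
    and Inl: "\<And>v x u x'. m (v, x) = Inl (u, x') \<Longrightarrow> u = v \<and> x' \<notin> pa D v \<and> (x' = x \<or> (x', x) \<in> D)"
    and Inr: "\<And>v x A. m (v, x) = Inr A \<Longrightarrow>
        \<exists>y. A = {y, v} \<and> y \<noteq> v \<and> (y, v) \<notin> B \<and> (y = x \<or> (y, x) \<in> B)"
  shows "\<exists>Y. HTC D B Y v \<and> (\<forall>y\<in>Y. \<exists>x. m (v, x) = Inr {y, v})"
proof -
  define stop where "stop x \<longleftrightarrow> (\<exists>A. m (v, x) = Inr A)" for x
  define prv where "prv x = (case m (v, x) of Inl (u, x') \<Rightarrow> x' | Inr A \<Rightarrow> x)" for x
  have m_prv: "m (v, x) = Inl (v, prv x)" if "\<not> stop x" for x
    using that Inl[of v x] unfolding stop_def prv_def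
    by (cases "m (v, x)") auto
  have prv: "prv x \<notin> pa D v" "prv x = x \<or> (prv x, x) \<in> D" if "\<not> stop x" for x
    using Inl[OF m_prv[OF that]] by auto
  have prv_inj: "x = x'" if "\<not> stop x" "\<not> stop x'" "prv x = prv x'" for x x'
    using injD[OF inj, of "(v, x)" "(v, x')"] m_prv[OF that(1)] m_prv[OF that(2)] that(3) by simp
  define s where "s p n = (prv ^^ n) p" for p n
  have s0: "s p 0 = p" and sSuc: "s p (Suc n) = prv (s p n)" for p n by (simp_all add: s_def)
  text \<open>Two coinciding backward walks can be cancelled step by step, until one of them is back at
    a parent of v, which no backward step reaches.\<close>
  have eq: "i = j \<and> p = q" if "p \<in> pa D v" "q \<in> pa D v" "s p i = s q j"
    "\<forall>k<i. \<not> stop (s p k)" "\<forall>k<j. \<not> stop (s q k)" for p q i j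
    using that
  proof (induction i arbitrary: j)
    case 0
    show ?case
    proof (cases j)
      case (Suc j')
      then have "s q j \<notin> pa D v" using prv(1)[of "s q j'"] 0(5) by (simp add: sSuc)
      then show ?thesis using 0 by (simp add: s0)
    qed (use 0 in \<open>simp add: s0\<close>)
  next
    case (Suc i)
    show ?case
    proof (cases j)
      case 0
      have "s p (Suc i) \<notin> pa D v" using prv(1)[of "s p i"] Suc.prems(4) by (simp add: sSuc)
      then show ?thesis using Suc.prems 0 by (simp add: s0)
    next
      case (Suc j')
      then have "s p i = s q j'" using prv_inj Suc.prems by (simp add: sSuc)
      then show ?thesis using Suc.IH[of j'] Suc.prems Suc by simp
    qed
  qed
  \<comment> \<open>A walk that never stopped would never repeat a node, by \<open>eq\<close> with
    both starting points equal, contradicting finiteness.\<close>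
  have "\<exists>n. stop (s p n)" if "p \<in> pa D v" for p
  proof (rule ccontr)
    assume "\<nexists>n. stop (s p n)"
    then have "inj (s p)" using eq[OF that that] by (auto intro: injI)
    then show False using finite_imageD[of "s p" UNIV] by simp
  qed
  then have ex: "\<exists>n. stop (s p n) \<and> (\<forall>k<n. \<not> stop (s p k))" if "p \<in> pa D v" for p
    using that exists_least_iff[of "\<lambda>n. stop (s p n)"] by blast
  then obtain n where n: "\<And>p. p \<in> pa D v \<Longrightarrow> stop (s p (n p))"
    "\<And>p k. p \<in> pa D v \<Longrightarrow> k < n p \<Longrightarrow> \<not> stop (s p k)" by metis
  have eq': "i = j \<and> p = q" if "p \<in> pa D v" "q \<in> pa D v" "i \<le> n p" "j \<le> n q" "s p i = s q j" for p q i j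
    using eq[OF that(1,2,5)] n(2)[OF that(1)] n(2)[OF that(2)] that(3,4) by simp
  have "\<exists>y. m (v, s p (n p)) = Inr {y, v} \<and> y \<noteq> v \<and> (y, v) \<notin> B \<and> (y = s p (n p) \<or> (y, s p (n p)) \<in> B)"
    if "p \<in> pa D v" for p
    using n(1)[OF that] Inr unfolding stop_def by metis
  then obtain y where y: "\<And>p. p \<in> pa D v \<Longrightarrow> m (v, s p (n p)) = Inr {y p, v}"
    "\<And>p. p \<in> pa D v \<Longrightarrow> y p \<noteq> v \<and> (y p, v) \<notin> B \<and> (y p = s p (n p) \<or> (y p, s p (n p)) \<in> B)"
    by metis
  have y_inj: "inj_on y (pa D v)"
  proof (rule inj_onI)
    fix p q assume pq: "p \<in> pa D v" "q \<in> pa D v" "y p = y q"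
    then have "m (v, s p (n p)) = m (v, s q (n q))" using y(1)[OF pq(1)] y(1)[OF pq(2)] by simp
    then have "s p (n p) = s q (n q)" using inj by (simp add: inj_eq)
    then show "p = q" using eq'[OF pq(1,2)] by blast
  qed
  \<comment> \<open>The walk runs against the edges, hence the reversal. It has
    \<open>Suc (n p)\<close> nodes, the stopping node included.\<close>
  define R where "R p = map (\<lambda>i. s p (n p - i)) [0..<Suc (n p)]" for p
  have len: "length (R p) = Suc (n p)" and nth: "i \<le> n p \<Longrightarrow> R p ! i = s p (n p - i)" for p i
    by (simp_all add: R_def del: upt_Suc)
  have hdR: "hd (R p) = s p (n p)" for p
    using nth[of 0 p] len[of p] by (metis diff_zero hd_conv_nth le0 length_0_conv nat.simps(3))
  have lastR: "last (R p) = p" for p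
    using nth[of "n p" p] len[of p] by (metis Zero_not_Suc diff_Suc_1 diff_self_eq_0 last_conv_nth le_refl list.size(3) s0)
  have setR: "set (R p) = s p ` {..n p}" for p
  proof -
    have "set (R p) = (\<lambda>i. s p (n p - i)) ` {..n p}"
      by (auto simp: R_def simp del: upt_Suc)
    also have "\<dots> = s p ` (\<lambda>i. n p - i) ` {..n p}" by (simp add: image_image)
    also have "(\<lambda>i. n p - i) ` {..n p} = {..n p}"
      by (auto simp: image_iff) (metis atMost_iff diff_diff_cancel diff_le_self)
    finally show ?thesis .
  qed
  have chain: "directed_chain D (R p)" if p: "p \<in> pa D v" for p
    unfolding directed_chain_def
  proof (intro conjI allI impI)
    show "R p \<noteq> []" using len[of p] by auto
    fix i assume "Suc i < length (R p)"
    then have i: "Suc i \<le> n p" by (simp add: len)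
    define k where "k = n p - Suc i"
    have k: "n p - i = Suc k" "k < n p" using i by (auto simp: k_def)
    \<comment> \<open>A match on the diagonal of I - Lambda would make the walk stand still; as
      nodes do not repeat, every step is an edge.\<close>
    have "s p (Suc k) \<noteq> s p k" using eq'[OF p p, of "Suc k" k] k by auto
    then have "(s p (Suc k), s p k) \<in> D" using prv(2)[OF n(2)[OF p k(2)]] by (simp add: sSuc)
    then show "(R p ! i, R p ! Suc i) \<in> D" using nth[of i p] nth[of "Suc i" p] i k
      by (simp add: k_def)
  qed
  define Y where "Y = y ` pa D v"
  define \<pi> where "\<pi> = the_inv_into (pa D v) y"
  have \<pi>: "\<pi> (y p) = p" if "p \<in> pa D v" for p
    using that y_inj by (simp add: \<pi>_def the_inv_into_f_f)
  define \<tau> where "\<tau> z = ([z], R (\<pi> z))" for z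
  have half: "is_half_trek D B (\<tau> z)" if z: "z \<in> Y" for z
  proof -
    obtain p where p: "p \<in> pa D v" "z = y p" using z by (auto simp: Y_def)
    show ?thesis using chain[OF p(1)] y(2)[OF p(1)] \<pi>[OF p(1)] p(2) by (simp add: \<tau>_def hdR)
  qed
  have "trek_system_nsi D B Y (pa D v) \<tau>"
    unfolding trek_system_nsi_def
  proof (intro conjI ballI impI)
    fix z assume "z \<in> Y"
    then show "is_trek D B (\<tau> z)" using half by (simp add: is_half_trek_def)
    show "trek_src (\<tau> z) = z" by (simp add: \<tau>_def trek_src_def)
  next
    have "trek_tgt \<circ> \<tau> = \<pi>" by (simp add: fun_eq_iff \<tau>_def trek_tgt_def lastR)
    moreover have "bij_betw \<pi> Y (pa D v)" unfolding \<pi>_def Y_def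
      by (rule bij_betw_the_inv_into) (simp add: bij_betw_def y_inj)
    ultimately show "bij_betw (trek_tgt \<circ> \<tau>) Y (pa D v)" by simp
  next
    fix z z' assume z: "z \<in> Y" "z' \<in> Y" "z \<noteq> z'"
    then show "trek_Left (\<tau> z) \<inter> trek_Left (\<tau> z') = {}" by (simp add: \<tau>_def trek_Left_def)
    obtain p p' where p: "p \<in> pa D v" "z = y p" "p' \<in> pa D v" "z' = y p'" "p \<noteq> p'"
      using z by (auto simp: Y_def)
    have "s p i \<noteq> s p' j" if "i \<le> n p" "j \<le> n p'" for i j
      using eq'[OF p(1,3) that] p(5) by blast
    then show "trek_Right (\<tau> z) \<inter> trek_Right (\<tau> z') = {}"
      using p \<pi> by (auto simp: \<tau>_def trek_Right_def setR)
  qed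
  moreover have "card Y = card (pa D v)" by (simp add: Y_def card_image y_inj)
  moreover have "Y \<inter> ({v} \<union> sib B v) = {}" using y(2) by (auto simp: Y_def sib_def)
  ultimately have "HTC D B Y v" unfolding HTC_def using half by blast
  moreover have "\<forall>z\<in>Y. \<exists>x. m (v, x) = Inr {z, v}" using y(1) by (auto simp: Y_def)
  ultimately show ?thesis by blast
qed

text \<open>Delta is a tangent direction for Lambda. When Lambda moves along it with Sigma fixed,
  Omega changes to first order by -(M + M^T) with M = Omega (I - Lambda)^(-1) Delta; the last
  condition keeps this change within the zero pattern of \<open>B\<close>.\<close>

lemma HTC_infinite_to_one_imp_kernel:
  fixes D B :: "('n::finite \<times> 'n) set"
  assumes B: "sym B" and inf: "HTC_infinite_to_one D B" and \<theta>: "\<theta> \<in> regular_pairs D B"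
  shows "\<exists>\<Delta>. \<Delta> \<noteq> 0 \<and> (\<forall>v w. (v, w) \<notin> D \<longrightarrow> \<Delta> $ v $ w = 0) \<and>
    (\<forall>y v. y \<noteq> v \<and> (y, v) \<notin> B \<longrightarrow>
       (snd \<theta> ** matrix_inv (mat 1 - fst \<theta>) ** \<Delta>) $ y $ v +
       (snd \<theta> ** matrix_inv (mat 1 - fst \<theta>) ** \<Delta>) $ v $ y = 0)"
proof (rule ccontr)
  assume no: "\<not> ?thesis"
  define \<Lambda> \<Omega> N where "\<Lambda> = fst \<theta>" and "\<Omega> = snd \<theta>" and "N = matrix_inv (mat 1 - fst \<theta>)"
  have N: "N ** (mat 1 - \<Lambda>) = mat 1"
    unfolding N_def \<Lambda>_def using invertible_regular_pairs[OF \<theta>]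
    by (intro matrix_inv_inverse) (simp add: invertible_det_nz)
  have \<Lambda>0: "\<And>v w. (v, w) \<notin> D \<Longrightarrow> \<Lambda> $ v $ w = 0"
    and \<Omega>0: "\<And>v w. v \<noteq> w \<Longrightarrow> (v, w) \<notin> B \<Longrightarrow> \<Omega> $ v $ w = 0"
    using \<theta> by (auto simp: regular_pairs_def RDreg_def \<Lambda>_def \<Omega>_def)
  \<comment> \<open>The unknown for column (v, x) is entry (x, v) of W = N Delta. Rows
    \<open>Inl (v, x')\<close> say that (I - Lambda) W is supported on \<open>D\<close>, rows
    \<open>Inr {y, v}\<close> that Omega W plus its transpose vanishes at (y, v). The sum over y has
    at most one nonzero term; it merely avoids naming the partner of v in \<open>A\<close>.\<close>
  define k :: "'n \<times> 'n \<Rightarrow> real^(('n \<times> 'n) + 'n set)" where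
    "k = (\<lambda>(v, x). \<chi> r. case r of
        Inl (u, x') \<Rightarrow> if u = v \<and> x' \<notin> pa D v then (mat 1 - \<Lambda>) $ x' $ x else 0
      | Inr A \<Rightarrow> \<Sum>y\<in>UNIV. if A = {y, v} \<and> y \<noteq> v \<and> (y, v) \<notin> B then \<Omega> $ y $ x else 0)"
  have kl: "k (v, x) $ Inl (u, x') = (if u = v \<and> x' \<notin> pa D v then (mat 1 - \<Lambda>) $ x' $ x else 0)"
    and kr: "k (v, x) $ Inr A = (\<Sum>y\<in>UNIV. if A = {y, v} \<and> y \<noteq> v \<and> (y, v) \<notin> B then \<Omega> $ y $ x else 0)"
    for v x u x' A by (simp_all add: k_def)
  have "\<forall>c\<in>UNIV. a c = 0" if a: "(\<Sum>c\<in>UNIV. a c *\<^sub>R k c) = 0" for a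
  proof -
    define W where "W = (\<chi> x v. a (v, x))"
    define U where "U = (mat 1 - \<Lambda>) ** W"
    have W: "W = N ** U" using N by (simp add: U_def matrix_mul_assoc)
    have comp: "(\<Sum>u\<in>UNIV. \<Sum>x\<in>UNIV. a (u, x) * k (u, x) $ r) = 0" for r
    proof -
      have "(\<Sum>u\<in>UNIV. \<Sum>x\<in>UNIV. a (u, x) * k (u, x) $ r) = (\<Sum>c\<in>UNIV. a c *\<^sub>R k c) $ r"
        by (simp add: sum.cartesian_product split_def)
      then show ?thesis using a by simp
    qed
    have UD: "U $ x' $ v = 0" if "(x', v) \<notin> D" for x' v
    proof -
      have "a (u, x) * k (u, x) $ Inl (v, x') = (if u = v then (mat 1 - \<Lambda>) $ x' $ x * W $ x $ v else 0)" for u x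
        using that by (simp add: kl W_def pa_def)
      then have "(\<Sum>u\<in>UNIV. \<Sum>x\<in>UNIV. a (u, x) * k (u, x) $ Inl (v, x')) =
          (\<Sum>u\<in>UNIV. if u = v then U $ x' $ v else 0)"
        by (intro sum.cong) (auto simp: U_def matrix_matrix_mult_def)
      then show ?thesis using comp[of "Inl (v, x')"] by simp
    qed
    have UK: "(\<Omega> ** N ** U) $ y $ v + (\<Omega> ** N ** U) $ v $ y = 0" if yv: "y \<noteq> v" "(y, v) \<notin> B" for y v
    proof -
      have vy: "(v, y) \<notin> B" using yv(2) B by (auto simp: sym_def)
      have "k (u, x) $ Inr {y, v} = (if u = v then \<Omega> $ y $ x else 0) + (if u = y then \<Omega> $ v $ x else 0)" for u x
      proof -
        have "(if {y, v} = {z, u} \<and> z \<noteq> u \<and> (z, u) \<notin> B then \<Omega> $ z $ x else 0) =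
          (if z = y then if u = v then \<Omega> $ y $ x else 0 else 0) + (if z = v then if u = y then \<Omega> $ v $ x else 0 else 0)" for z
          using yv vy by (auto simp: doubleton_eq_iff)
        then show ?thesis unfolding kr by (simp add: sum.distrib)
      qed
      then have "(\<Sum>x\<in>UNIV. a (u, x) * k (u, x) $ Inr {y, v}) =
          (if u = v then (\<Omega> ** W) $ y $ v else 0) + (if u = y then (\<Omega> ** W) $ v $ y else 0)" for u
        using yv(1) by (auto simp: matrix_matrix_mult_def W_def mult.commute)
      then have "(\<Sum>u\<in>UNIV. \<Sum>x\<in>UNIV. a (u, x) * k (u, x) $ Inr {y, v}) =
          (\<Omega> ** W) $ y $ v + (\<Omega> ** W) $ v $ y" by (simp add: sum.distrib)
      then show ?thesis using comp[of "Inr {y, v}"] W by (simp add: matrix_mul_assoc)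
    qed
    have "U = 0"
    proof (rule ccontr)
      assume "U \<noteq> 0"
      show False
        by (rule notE[OF no], intro exI[of _ U] conjI allI impI)
           (use \<open>U \<noteq> 0\<close> UD UK in \<open>auto simp: \<Omega>_def N_def\<close>)
    qed
    then have "W = 0" using W by (simp add: vec_eq_iff matrix_matrix_mult_def)
    then show ?thesis by (simp add: W_def vec_eq_iff)
  qed
  from independent_imp_matching[OF finite this]
  obtain m where m: "inj m" "\<And>c. k c $ m c \<noteq> 0" by blast
  have "\<exists>Y. HTC D B Y v \<and> (\<forall>y\<in>Y. \<exists>x. m (v, x) = Inr {y, v})" for v
  proof (rule matching_imp_HTC[OF B m(1)])
    fix v x u x' assume "m (v, x) = Inl (u, x')"
    then have "k (v, x) $ Inl (u, x') \<noteq> 0" using m(2)[of "(v, x)"] by simp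
    then show "u = v \<and> x' \<notin> pa D v \<and> (x' = x \<or> (x', x) \<in> D)"
      using \<Lambda>0[of x' x] by (auto simp: kl mat_def split: if_splits)
  next
    fix v x A assume "m (v, x) = Inr A"
    then have "k (v, x) $ Inr A \<noteq> 0" using m(2)[of "(v, x)"] by simp
    then obtain y where "(if A = {y, v} \<and> y \<noteq> v \<and> (y, v) \<notin> B then \<Omega> $ y $ x else 0) \<noteq> 0"
      unfolding kr by (blast elim: sum.not_neutral_contains_not_neutral)
    then show "\<exists>y. A = {y, v} \<and> y \<noteq> v \<and> (y, v) \<notin> B \<and> (y = x \<or> (y, x) \<in> B)"
      using \<Omega>0[of y x] by (auto split: if_splits)
  qed
  then obtain Y where Y: "\<And>v. HTC D B (Y v) v" "\<And>v y. y \<in> Y v \<Longrightarrow> \<exists>x. m (v, x) = Inr {y, v}" by metis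
  from inf[unfolded HTC_infinite_to_one_def, rule_format, of Y] Y(1)
  obtain v w where vw: "v \<noteq> w" "v \<in> Y w" "w \<in> Y v" by auto
  \<comment> \<open>A mutual pair would use the row of the unordered pair {v, w} twice, once from a
    column of v and once from a column of w.\<close>
  obtain x x' where "m (v, x) = Inr {w, v}" "m (w, x') = Inr {v, w}" using Y(2) vw(2,3) by blast
  then have "m (v, x) = m (w, x')" by (simp add: insert_commute)
  then show False using injD[OF m(1)] vw(1) by fastforce
qed

subsection \<open>Maps of locally maximal rank\<close>

definition kernel_projection :: "('a::euclidean_space \<Rightarrow> 'b::euclidean_space) \<Rightarrow> ('a \<Rightarrow> 'a) \<Rightarrow> bool" where
  "kernel_projection L \<pi> \<longleftrightarrow> linear \<pi> \<and> (\<forall>z. L (\<pi> z) = 0) \<and> (\<forall>z k. L k = 0 \<longrightarrow> (z - \<pi> z) \<bullet> k = 0)"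

lemma kernel_projection_exists:
  fixes L :: "'a::euclidean_space \<Rightarrow> 'b::euclidean_space"
  assumes "linear L"
  shows "\<exists>\<pi>. kernel_projection L \<pi>"
proof -
  have sub: "subspace {z. L z = 0}" using assms by (rule linear_subspace_kernel)
  obtain Bs where Bs: "Bs \<subseteq> {z. L z = 0}" "pairwise orthogonal Bs" "\<And>x. x \<in> Bs \<Longrightarrow> norm x = 1"
    "independent Bs" "span Bs = {z. L z = 0}" using orthonormal_basis_subspace[OF sub] by metis
  have fin: "finite Bs" using Bs(4) by (rule independent_imp_finite)
  define \<pi> where "\<pi> z = (\<Sum>b\<in>Bs. (z \<bullet> b) *\<^sub>R b)" for z
  have "linear \<pi>"
    unfolding \<pi>_def by (rule linearI) (simp_all add: inner_add_left scaleR_left_distrib sum.distrib scaleR_sum_right)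
  moreover have "L (\<pi> z) = 0" for z
  proof -
    have "\<pi> z \<in> span Bs" unfolding \<pi>_def by (intro span_sum span_scale span_base)
    then show ?thesis using Bs(5) by simp
  qed
  moreover have "(z - \<pi> z) \<bullet> k = 0" if "L k = 0" for z k
  proof -
    have "(z - \<pi> z) \<bullet> b = 0" if b: "b \<in> Bs" for b
    proof -
      have "((z \<bullet> b') *\<^sub>R b') \<bullet> b = (if b' = b then z \<bullet> b else 0)" if "b' \<in> Bs" for b'
        using Bs(2,3) b that by (auto simp: pairwise_def orthogonal_def norm_eq_1)
      then have "\<pi> z \<bullet> b = (\<Sum>b'\<in>Bs. if b' = b then z \<bullet> b else 0)"
        unfolding \<pi>_def inner_sum_left by (intro sum.cong) auto
      then show ?thesis using fin b by (simp add: inner_diff_left)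
    qed
    moreover have "k \<in> span Bs" using that Bs(5) by simp
    ultimately show ?thesis
      using orthogonal_to_span[of k Bs "z - \<pi> z"] by (simp add: orthogonal_def)
  qed
  ultimately show ?thesis unfolding kernel_projection_def by blast
qed

section \<open>Completing a linear map to an automorphism by its kernel\<close>

context
  fixes L :: "'a::euclidean_space \<Rightarrow> 'b::euclidean_space" and \<pi>
  assumes L: "linear L" and \<pi>: "kernel_projection L \<pi>"
begin

lemma adjoint_orthogonal_kernel: "L k = 0 \<Longrightarrow> adjoint L w \<bullet> k = 0"
  by (simp add: adjoint_works[OF L] inner_commute)

lemma kernel_projection_fixes: "L k = 0 \<Longrightarrow> \<pi> k = k"
proof -
  assume k: "L k = 0"
  have "L (k - \<pi> k) = 0" using k \<pi> by (simp add: kernel_projection_def linear_diff[OF L])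
  then have "(k - \<pi> k) \<bullet> (k - \<pi> k) = 0" using \<pi> unfolding kernel_projection_def by blast
  then show ?thesis by simp
qed

lemma kernel_projection_orthogonal:
  assumes "\<And>k. L k = 0 \<Longrightarrow> z \<bullet> k = 0"
  shows "\<pi> z = 0"
proof -
  have "(z - \<pi> z) \<bullet> \<pi> z = 0" "z \<bullet> \<pi> z = 0" using \<pi> assms by (auto simp: kernel_projection_def)
  then show ?thesis by (simp add: inner_diff_left)
qed

lemma adjoint_add_kernel_eq_0:
  assumes "adjoint L w + k = 0" "L k = 0"
  shows "adjoint L w = 0 \<and> k = 0"
proof -
  have "(adjoint L w + k) \<bullet> k = k \<bullet> k" using adjoint_orthogonal_kernel[OF assms(2)] by (simp add: inner_add_left)
  then show ?thesis using assms by simp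
qed

text \<open>The range of the adjoint is orthogonal to the kernel, so both summands vanish
  separately. The point is to have an endomorphism, whose invertibility is a determinant condition,
  in place of a map between different spaces.\<close>

lemma rank_corrected_injective: "inj (\<lambda>z. adjoint L (L z) + \<pi> z)"
proof -
  have lin: "linear (\<lambda>z. adjoint L (L z) + \<pi> z)"
    using \<pi> linear_compose[OF L adjoint_linear[OF L]]
    by (auto simp: kernel_projection_def comp_def intro: linear_compose_add)
  have "z = 0" if z: "adjoint L (L z) + \<pi> z = 0" for z
  proof -
    have "L (\<pi> z) = 0" using \<pi> by (simp add: kernel_projection_def)
    from adjoint_add_kernel_eq_0[OF z this] have 0: "adjoint L (L z) = 0" "\<pi> z = 0" by auto
    have "L z \<bullet> L z = adjoint L (L z) \<bullet> z" by (simp add: adjoint_works[OF L] inner_commute)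
    then have "L z = 0" using 0 by simp
    then show ?thesis using kernel_projection_fixes 0 by simp
  qed
  then show ?thesis using linear_injective_0[OF lin] by blast
qed

context
  fixes M :: "'a \<Rightarrow> 'b"
  assumes M: "linear M" and inj: "inj (\<lambda>z. adjoint L (M z) + \<pi> z)"
begin

text \<open>On the orthogonal complement \<open>Kp\<close> of the kernel of L the correction
  \<open>\<pi>\<close> is zero, so the adjoint of L composed with M is injective there, and
  therefore so is M. As L maps \<open>Kp\<close> isomorphically onto its range, dimensions
  agree.\<close>

lemma rank_corrected_aux:
  defines "Kp \<equiv> {z. \<forall>k. L k = 0 \<longrightarrow> z \<bullet> k = 0}"
  shows "subspace Kp" "\<And>z. z \<in> Kp \<Longrightarrow> adjoint L (M z) = 0 \<Longrightarrow> z = 0" "dim (M ` Kp) = dim (range L)"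
proof -
  show sub: "subspace Kp" by (auto simp: Kp_def subspace_def inner_add_left)
  show zero: "z = 0" if "z \<in> Kp" "adjoint L (M z) = 0" for z
  proof -
    have "\<pi> z = 0" using that(1) kernel_projection_orthogonal by (simp add: Kp_def)
    moreover have "\<pi> 0 = 0" using kernel_projection_fixes linear_0[OF L] by simp
    ultimately show ?thesis
      using injD[OF inj, of z 0] that(2) linear_0[OF M] linear_0[OF adjoint_linear[OF L]] by simp
  qed
  have span: "span Kp = Kp" using sub by (simp add: span_eq_iff)
  have injM: "inj_on M (span Kp)"
    unfolding span linear_inj_on_iff_eq_0[OF M sub]
    using zero linear_0[OF adjoint_linear[OF L]] by auto
  have injL: "inj_on L (span Kp)"
    unfolding span linear_inj_on_iff_eq_0[OF L sub] by (auto simp: Kp_def)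
  have "L ` Kp = range L"
  proof
    show "range L \<subseteq> L ` Kp"
    proof
      fix w assume "w \<in> range L"
      then obtain z where z: "w = L z" by blast
      have "z - \<pi> z \<in> Kp" using \<pi> by (simp add: Kp_def kernel_projection_def)
      moreover have "L (z - \<pi> z) = w" using z \<pi> by (simp add: linear_diff[OF L] kernel_projection_def)
      ultimately show "w \<in> L ` Kp" by blast
    qed
  qed auto
  then show "dim (M ` Kp) = dim (range L)"
    using dim_image_eq[OF M injM] dim_image_eq[OF L injL] by simp
qed

lemma rank_corrected_rank: "dim (range L) \<le> dim (range M)"
proof -
  have "dim (M ` {z. \<forall>k. L k = 0 \<longrightarrow> z \<bullet> k = 0}) \<le> dim (range M)"
    by (rule dim_subset) (rule image_mono, simp)
  then show ?thesis using rank_corrected_aux(3) by simp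
qed

text \<open>If the rank of M does not exceed that of L, then M already attains its whole range on
  \<open>Kp\<close>, where the adjoint of L loses nothing.\<close>

lemma rank_corrected_kernel:
  assumes "dim (range M) \<le> dim (range L)" "adjoint L (M u) = 0"
  shows "M u = 0"
proof -
  let ?K = "{z. \<forall>k. L k = 0 \<longrightarrow> z \<bullet> k = 0}"
  have "subspace (M ` ?K)" "subspace (range M)"
    by (rule linear_subspace_image[OF M rank_corrected_aux(1)])
       (rule linear_subspace_image[OF M subspace_UNIV])
  moreover have "M ` ?K \<subseteq> range M" by (rule image_mono) simp
  moreover have "dim (range M) \<le> dim (M ` ?K)" using rank_corrected_aux(3) assms(1) by simp
  ultimately have "M ` ?K = range M" by (rule subspace_dim_equal)
  then have "M u \<in> M ` ?K" by simp
  then obtain z where z: "z \<in> ?K" "M u = M z" by (rule imageE)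
  then have "z = 0" using rank_corrected_aux(2) assms(2) by simp
  then show ?thesis using z(2) linear_0[OF M] by simp
qed

end

end

text \<open>The map g = L^T f + pi is a local diffeomorphism, and c(t) is the preimage of g(x0) + t
  kappa. Maximality of the rank forces f to be constant along c. The orthogonality clause fixes the
  kernel component of c(t) - x0 exactly; it later shows that the curve does not collapse in
  parameter space.\<close>

lemma constant_rank_fibre:
  fixes f :: "'a::euclidean_space \<Rightarrow> 'b::euclidean_space"
  assumes U: "open U" "x0 \<in> U"
    and der: "\<And>x. x \<in> U \<Longrightarrow> (f has_derivative f' x) (at x)"
    and cont: "\<And>u. continuous_on U (\<lambda>x. f' x u)"
    and rank: "\<And>x. x \<in> U \<Longrightarrow> dim (range (f' x)) \<le> dim (range (f' x0))"
    and \<kappa>: "f' x0 \<kappa> = 0"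
  shows "\<exists>\<epsilon>>0. \<exists>c :: real \<Rightarrow> 'a. \<forall>t. \<bar>t\<bar> < \<epsilon> \<longrightarrow>
    c t \<in> U \<and> f (c t) = f x0 \<and> (\<forall>k. f' x0 k = 0 \<longrightarrow> (c t - x0 - t *\<^sub>R \<kappa>) \<bullet> k = 0)"
proof -
  have lin: "linear (f' x)" if "x \<in> U" for x using der[OF that] by (rule has_derivative_linear)
  define L where "L = f' x0"
  have L: "linear L" using lin U(2) by (simp add: L_def)
  obtain \<pi> where \<pi>: "kernel_projection L \<pi>" using kernel_projection_exists[OF L] by blast
  have \<pi>lin: "bounded_linear \<pi>" and L\<pi>: "\<And>z. L (\<pi> z) = 0"
    using \<pi> by (auto simp: kernel_projection_def linear_linear)
  have adj: "bounded_linear (adjoint L)" using adjoint_linear[OF L] by (simp add: linear_linear)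
  define g where "g x = adjoint L (f x) + \<pi> x" for x
  define G where "G x u = adjoint L (f' x u) + \<pi> u" for x u
  have blin: "bounded_linear (G x)" if "x \<in> U" for x
    unfolding G_def
    using lin[OF that] adj \<pi>lin by (intro bounded_linear_add bounded_linear_compose[OF adj])
      (simp_all add: linear_linear)
  have gder: "(g has_derivative G x) (at x)" if "x \<in> U" for x
    unfolding g_def G_def
    by (intro has_derivative_add bounded_linear.has_derivative[OF adj] der that
        bounded_linear_imp_has_derivative \<pi>lin)
  define F where "F x = Blinfun (G x)" for x
  have F: "blinfun_apply (F x) = G x" if "x \<in> U" for x
    using blin[OF that] by (simp add: F_def bounded_linear_Blinfun_apply)
  have "continuous_on U (\<lambda>x. G x u)" for u
    unfolding G_def
    by (intro continuous_intros bounded_linear.continuous_on[OF adj] cont)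
  then have contF: "continuous_on U F"
    by (intro continuous_on_blinfun_componentwise) (simp add: F cong: continuous_on_cong)
  have "inj (G x0)" unfolding G_def using rank_corrected_injective[OF L \<pi>] by (simp add: L_def)
  then obtain I where I: "linear I" "I \<circ> G x0 = id"
    using linear_injective_left_inverse[OF bounded_linear.linear[OF blin[OF U(2)]]] by blast
  have invF: "Blinfun I o\<^sub>L F x0 = id_blinfun"
    using I U(2) by (intro blinfun_eqI)
      (simp add: F bounded_linear_Blinfun_apply linear_linear fun_eq_iff)
  have gF: "(g has_derivative blinfun_apply (F x)) (at x)" if "x \<in> U" for x
    using gder F that by simp
  obtain U' V h h' where h: "open U'" "U' \<subseteq> U" "x0 \<in> U'" "open V" "g x0 \<in> V" "homeomorphism U' V g h"
    "\<And>y. y \<in> V \<Longrightarrow> (h has_derivative (h' y)) (at y)"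
    "\<And>y. y \<in> V \<Longrightarrow> h' y = inv (blinfun_apply (F (h y)))"
    "\<And>y. y \<in> V \<Longrightarrow> bij (blinfun_apply (F (h y)))"
  proof (rule inverse_function_theorem[OF U(1) gF contF U(2) invF])
  qed (assumption, rule that, assumption+)
  have hV: "h y \<in> U" "g (h y) = y" if "y \<in> V" for y
    using h(2,6) that by (auto simp: homeomorphism_def)
  obtain e where e: "e > 0" "ball (g x0) e \<subseteq> V" using h(4,5) open_contains_ball by blast
  define y where "y t = g x0 + t *\<^sub>R \<kappa>" for t
  define c where "c t = h (y t)" for t
  define \<epsilon> where "\<epsilon> = e / (norm \<kappa> + 1)"
  have \<epsilon>: "\<epsilon> > 0" using e(1) by (simp add: \<epsilon>_def add_nonneg_pos)
  have yV: "y t \<in> V" if "\<bar>t\<bar> < \<epsilon>" for t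
  proof -
    have "\<bar>t\<bar> * norm \<kappa> \<le> \<bar>t\<bar> * (norm \<kappa> + 1)" by (simp add: mult_left_mono)
    also have "\<dots> < e" using that by (simp add: \<epsilon>_def pos_less_divide_eq add_nonneg_pos)
    finally show ?thesis using e(2) by (auto simp: y_def dist_norm)
  qed
  have L\<kappa>: "L \<kappa> = 0" using \<kappa> by (simp add: L_def)
  have cU: "c t \<in> U" and gc: "g (c t) = y t" if "\<bar>t\<bar> < \<epsilon>" for t
    using hV[OF yV[OF that]] by (auto simp: c_def)
  have orth: "(c t - x0 - t *\<^sub>R \<kappa>) \<bullet> k = 0" if t: "\<bar>t\<bar> < \<epsilon>" and k: "L k = 0" for t k
  proof -
    \<comment> \<open>The equation g(c t) = g(x0) + t kappa splits into its parts in the range of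
      the adjoint and in the kernel; the kernel part is the one wanted.\<close>
    have "adjoint L (f (c t) - f x0) + (\<pi> (c t - x0) - t *\<^sub>R \<kappa>) = 0"
      using gc[OF t] by (simp add: g_def y_def linear_diff[OF adjoint_linear[OF L]]
          linear_diff[OF bounded_linear.linear[OF \<pi>lin]] algebra_simps)
    moreover have "L (\<pi> (c t - x0) - t *\<^sub>R \<kappa>) = 0"
      by (simp add: linear_diff[OF L] L\<pi> linear_scale[OF L] L\<kappa>)
    ultimately have "\<pi> (c t - x0) - t *\<^sub>R \<kappa> = 0"
      by (rule adjoint_add_kernel_eq_0[OF L \<pi>, THEN conjunct2])
    then have "c t - x0 - t *\<^sub>R \<kappa> = (c t - x0) - \<pi> (c t - x0)" by simp
    then show ?thesis using \<pi> k unfolding kernel_projection_def by metis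
  qed
  have "\<exists>w. \<forall>t\<in>{-\<epsilon><..<\<epsilon>}. f (c t) = w"
  proof (rule has_derivative_zero_constant)
    fix t assume "t \<in> {-\<epsilon><..<\<epsilon>}"
    then have t: "\<bar>t\<bar> < \<epsilon>" by auto
    have inj: "inj (G (c t))" and inv: "h' (y t) = inv (G (c t))" and surj: "surj (G (c t))"
      using h(8,9)[OF yV[OF t]] F[OF cU[OF t]] by (auto simp: c_def bij_def)
    \<comment> \<open>\<open>u\<close> is the velocity of the curve. The kernel part of G(u) = kappa
      is again separated off, leaving that the adjoint of L kills f'(u).\<close>
    define u where "u = h' (y t) \<kappa>"
    have "G (c t) u = \<kappa>" unfolding u_def inv using surj by (simp add: surj_f_inv_f)
    then have "adjoint L (f' (c t) u) + (\<pi> u - \<kappa>) = 0" by (simp add: G_def add_diff_eq)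
    moreover have "L (\<pi> u - \<kappa>) = 0" by (simp add: linear_diff[OF L] L\<pi> L\<kappa>)
    ultimately have "adjoint L (f' (c t) u) = 0"
      by (rule adjoint_add_kernel_eq_0[OF L \<pi>, THEN conjunct1])
    then have 0: "f' (c t) u = 0"
      using rank_corrected_kernel[OF L \<pi> lin[OF cU[OF t]] inj[unfolded G_def]] rank[OF cU[OF t]]
      by (simp add: L_def)
    have "(y has_derivative (\<lambda>s. s *\<^sub>R \<kappa>)) (at t)"
      unfolding y_def by (auto intro!: derivative_eq_intros)
    from has_derivative_compose[OF this h(7)[OF yV[OF t]]]
    have "(c has_derivative (\<lambda>s. h' (y t) (s *\<^sub>R \<kappa>))) (at t)" by (simp add: c_def[abs_def])
    from has_derivative_compose[OF this der[OF cU[OF t]]]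
    have "((\<lambda>t. f (c t)) has_derivative (\<lambda>s. f' (c t) (h' (y t) (s *\<^sub>R \<kappa>)))) (at t)" .
    moreover have "f' (c t) (h' (y t) (s *\<^sub>R \<kappa>)) = 0" for s
      using 0 linear_scale[OF has_derivative_linear[OF h(7)[OF yV[OF t]]]]
        linear_scale[OF lin[OF cU[OF t]]] by (simp add: u_def)
    ultimately show "((\<lambda>t. f (c t)) has_derivative (\<lambda>s. 0)) (at t within {-\<epsilon><..<\<epsilon>})"
      by (simp add: has_derivative_at_withinI)
  qed simp
  then obtain w where w: "\<And>t. \<bar>t\<bar> < \<epsilon> \<Longrightarrow> f (c t) = w" by force
  have "c 0 = x0" using h(3,6) by (auto simp: c_def y_def homeomorphism_def)
  then have "f (c t) = f x0" if "\<bar>t\<bar> < \<epsilon>" for t using w[OF that] w[of 0] \<epsilon> by simp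
  then show ?thesis using \<epsilon> cU orth unfolding L_def by blast
qed

subsection \<open>Derivatives of rational functions\<close>

text \<open>Polynomiality is claimed in the base point for each fixed direction \<open>u\<close>;
  this is what rationality and continuity of the Jacobian need.\<close>

lemma polyfun_derivative:
  assumes "polyfun p"
  shows "\<exists>p'. (\<forall>x :: real^'k::finite. ((\<lambda>x. p (vec_nth x)) has_derivative p' x) (at x)) \<and>
    (\<forall>u. polyfun (\<lambda>c. p' (vec_lambda c) u))"
  using assms
proof induction
  case (pf_const c)
  show ?case by (intro exI[of _ "\<lambda>x u. 0"]) (auto intro: polyfun.pf_const)
next
  case (pf_var i)
  show ?case
    by (intro exI[of _ "\<lambda>x u. u $ i"])
       (auto intro: polyfun.pf_const bounded_linear_imp_has_derivative bounded_linear_vec_nth)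
next
  case (pf_add p q)
  then obtain p' q' where
    "\<forall>x::real^'k. ((\<lambda>x. p (vec_nth x)) has_derivative p' x) (at x)" "\<forall>u. polyfun (\<lambda>c. p' (vec_lambda c) u)"
    "\<forall>x::real^'k. ((\<lambda>x. q (vec_nth x)) has_derivative q' x) (at x)" "\<forall>u. polyfun (\<lambda>c. q' (vec_lambda c) u)"
    by blast
  then show ?case
    by (intro exI[of _ "\<lambda>x u. p' x u + q' x u"]) (auto intro: polyfun.pf_add has_derivative_add)
next
  case (pf_mult p q)
  then obtain p' q' where
    p': "\<And>x::real^'k. ((\<lambda>x. p (vec_nth x)) has_derivative p' x) (at x)" "\<And>u. polyfun (\<lambda>c. p' (vec_lambda c) u)"
    and q': "\<And>x::real^'k. ((\<lambda>x. q (vec_nth x)) has_derivative q' x) (at x)" "\<And>u. polyfun (\<lambda>c. q' (vec_lambda c) u)"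
    by blast
  have c: "vec_nth (vec_lambda c) = c" for c :: "'k \<Rightarrow> real" by (simp add: fun_eq_iff)
  have "polyfun (\<lambda>c. p c * q' (vec_lambda c) u + p' (vec_lambda c) u * q c)" for u
    by (rule polyfun.pf_add[OF polyfun.pf_mult[OF pf_mult.hyps(1) q'(2)] polyfun.pf_mult[OF p'(2) pf_mult.hyps(2)]])
  then show ?case using has_derivative_mult[OF p'(1) q'(1)]
    by (intro exI[of _ "\<lambda>x u. p (vec_nth x) * q' x u + p' x u * q (vec_nth x)"]) (simp only: c, blast)
qed

lemma rational_on_derivative:
  fixes g :: "real^'k::finite \<Rightarrow> real"
  assumes "open U" "rational_on vec_nth U g"
  shows "\<exists>g'. (\<forall>x\<in>U. (g has_derivative g' x) (at x)) \<and> (\<forall>u. rational_on vec_nth U (\<lambda>x. g' x u))"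
proof -
  obtain p q where pq: "polyfun p" "polyfun q" "\<And>x. x \<in> U \<Longrightarrow> q (vec_nth x) \<noteq> 0"
      "\<And>x. x \<in> U \<Longrightarrow> g x = p (vec_nth x) / q (vec_nth x)"
    using assms(2) unfolding rational_on_def by blast
  obtain p' where p': "\<And>x::real^'k. ((\<lambda>x. p (vec_nth x)) has_derivative p' x) (at x)"
      "\<And>u. polyfun (\<lambda>c. p' (vec_lambda c) u)" using polyfun_derivative[OF pq(1)] by blast
  obtain q' where q': "\<And>x::real^'k. ((\<lambda>x. q (vec_nth x)) has_derivative q' x) (at x)"
      "\<And>u. polyfun (\<lambda>c. q' (vec_lambda c) u)" using polyfun_derivative[OF pq(2)] by blast
  define g' where "g' x u = (p' x u * q (vec_nth x) - p (vec_nth x) * q' x u) / (q (vec_nth x) * q (vec_nth x))" for x u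
  have "(g has_derivative g' x) (at x)" if x: "x \<in> U" for x
  proof -
    have "((\<lambda>x. p (vec_nth x) / q (vec_nth x)) has_derivative g' x) (at x)"
      using has_derivative_divide'[OF p'(1) q'(1) pq(3)[OF x]] by (simp add: g'_def[abs_def])
    then show ?thesis
      by (rule has_derivative_transform_within_open[OF _ assms(1) x]) (simp add: pq(4))
  qed
  moreover have "rational_on vec_nth U (\<lambda>x. g' x u)" for u
  proof -
    have "rational_on vec_nth U (\<lambda>x. p' x u)" "rational_on vec_nth U (\<lambda>x. q' x u)"
      using polyfun_rational_on[OF p'(2)[of u], of vec_nth U] polyfun_rational_on[OF q'(2)[of u], of vec_nth U]
      by simp_all
    then show ?thesis unfolding g'_def
      using pq(3) by (intro rational_on_divide rational_on_diff rational_on_mult polyfun_rational_on pq) auto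
  qed
  ultimately show ?thesis by blast
qed

lemma rational_on_continuous:
  fixes g :: "real^'k::finite \<Rightarrow> real"
  assumes "open U" "rational_on vec_nth U g"
  shows "continuous_on U g"
  using rational_on_derivative[OF assms]
  by (meson continuous_at_imp_continuous_on has_derivative_continuous)

lemma has_derivative_matrixI:
  fixes f :: "'a::real_normed_vector \<Rightarrow> real^'n^'m"
  assumes "\<And>i j. ((\<lambda>x. f x $ i $ j) has_derivative (\<lambda>u. f' u $ i $ j)) (at x)"
  shows "(f has_derivative f') (at x)"
  unfolding has_derivative_componentwise_within[of f]
  using assms by (auto simp: Basis_vec_def inner_axis)

lemma continuous_on_matrixI:
  fixes f :: "'a::topological_space \<Rightarrow> real^'n^'m"
  assumes "\<And>i j. continuous_on U (\<lambda>x. f x $ i $ j)"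
  shows "continuous_on U f"
proof -
  have "continuous_on U (\<lambda>x. \<chi> i j. f x $ i $ j)"
    using assms by (intro continuous_on_vec_lambda)
  then show ?thesis by simp
qed

lemma rational_matrix_on_derivative:
  fixes f :: "real^'k::finite \<Rightarrow> real^'n^'m"
  assumes "open U" "rational_matrix_on vec_nth U f"
  shows "\<exists>f'. (\<forall>x\<in>U. (f has_derivative f' x) (at x)) \<and> (\<forall>u. rational_matrix_on vec_nth U (\<lambda>x. f' x u))"
proof -
  have "\<forall>i j. \<exists>g'. (\<forall>x\<in>U. ((\<lambda>x. f x $ i $ j) has_derivative g' x) (at x)) \<and>
      (\<forall>u. rational_on vec_nth U (\<lambda>x. g' x u))"
    using assms rational_on_derivative unfolding rational_matrix_on_def by blast
  then obtain g' where g': "\<And>i j x. x \<in> U \<Longrightarrow> ((\<lambda>x. f x $ i $ j) has_derivative g' i j x) (at x)"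
      "\<And>i j u. rational_on vec_nth U (\<lambda>x. g' i j x u)" by metis
  show ?thesis
    by (intro exI[of _ "\<lambda>x u. \<chi> i j. g' i j x u"] conjI ballI allI has_derivative_matrixI)
       (simp_all add: g' rational_matrix_on_def)
qed

lemma bounded_bilinear_matrix_mult:
  "bounded_bilinear ((**) :: real^'n^'m \<Rightarrow> real^'p^'n \<Rightarrow> real^'p^'m)"
  unfolding bilinear_conv_bounded_bilinear[symmetric] bilinear_def
  by (auto intro!: linearI simp: vec_eq_iff matrix_matrix_mult_def sum.distrib algebra_simps sum_distrib_left)

lemma matrix_diff_rdistrib:
  fixes A B :: "real^'n^'m"
  shows "(A - B) ** C = A ** C - B ** C"
  using bounded_bilinear.diff_left[OF bounded_bilinear_matrix_mult] .

subsection \<open>Generically infinite fibres\<close>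

text \<open>A linear map from all coordinate vectors onto the pairs with the prescribed zeros,
  symmetrizing the second component. It lets phi be differentiated on an open set of a Euclidean
  space, at the price of redundant directions on which it vanishes.\<close>

definition pair_of_coords ::
    "('n::finite \<times> 'n) set \<Rightarrow> ('n \<times> 'n) set \<Rightarrow> real^(('n \<times> 'n) + ('n \<times> 'n)) \<Rightarrow> (real^'n^'n) \<times> (real^'n^'n)" where
  "pair_of_coords D B x =
     (\<chi> i j. if (i, j) \<in> D then x $ Inl (i, j) else 0,
      \<chi> i j. if i = j \<or> (i, j) \<in> B then (x $ Inr (i, j) + x $ Inr (j, i)) / 2 else 0)"

definition coords_of_pair ::
    "(real^'n::finite^'n) \<times> (real^'n^'n) \<Rightarrow> real^(('n \<times> 'n) + ('n \<times> 'n))" where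
  "coords_of_pair \<theta> = vec_lambda (theta_coords \<theta>)"

lemma linear_pair_of_coords: "linear (pair_of_coords D B)"
  by (rule linearI) (auto simp: pair_of_coords_def vec_eq_iff algebra_simps add_divide_distrib)

lemma linear_coords_of_pair: "linear coords_of_pair"
  by (rule linearI) (auto simp: coords_of_pair_def theta_coords_def vec_eq_iff split: sum.split)

lemma pair_of_coords_of_pair:
  assumes "\<And>v w. (v, w) \<notin> D \<Longrightarrow> fst \<theta> $ v $ w = 0" "transpose (snd \<theta>) = snd \<theta>"
    "\<And>v w. v \<noteq> w \<Longrightarrow> (v, w) \<notin> B \<Longrightarrow> snd \<theta> $ v $ w = 0"
  shows "pair_of_coords D B (coords_of_pair \<theta>) = \<theta>"
proof -
  have "snd \<theta> $ i $ j = snd \<theta> $ j $ i" for i j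
    using assms(2) by (auto simp: transpose_def vec_eq_iff)
  then show ?thesis using assms(1,3)
    by (auto simp: prod_eq_iff pair_of_coords_def coords_of_pair_def theta_coords_def vec_eq_iff)
qed

lemma pair_of_coords_regular:
  assumes "sym B" "det (mat 1 - fst (pair_of_coords D B x)) \<noteq> 0"
  shows "pair_of_coords D B x \<in> regular_pairs D B"
  using assms by (auto simp: regular_pairs_def RDreg_def invertible_det_nz pair_of_coords_def
      transpose_def vec_eq_iff sym_def add.commute)

lemma regular_pairs_coords:
  "\<theta> \<in> regular_pairs D B \<Longrightarrow> pair_of_coords D B (coords_of_pair \<theta>) = \<theta>"
  by (rule pair_of_coords_of_pair) (auto simp: regular_pairs_def RDreg_def)

lemma transpose_phi:
  assumes "transpose (snd \<theta>) = snd \<theta>"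
  shows "transpose (phi \<theta>) = phi \<theta>"
  using assms by (simp add: phi_alt matrix_transpose_mul matrix_mul_assoc)

lemma inner_matrix_congruence:
  fixes P W :: "real^'n^'n"
  shows "x \<bullet> ((transpose P ** W ** P) *v x) = (P *v x) \<bullet> (W *v (P *v x))"
proof -
  have "x \<bullet> (transpose P *v y) = (P *v x) \<bullet> y" for y
    by (metis dot_lmul_matrix vector_transpose_matrix)
  then show ?thesis by (simp flip: matrix_vector_mul_assoc)
qed

text \<open>With equal Sigma the two matrices Omega are congruent through an invertible matrix, so
  positive definiteness carries over and a fibre curve need only stay in
  \<open>regular_pairs\<close>.\<close>

lemma Theta_if_phi_eq:
  assumes "\<theta> \<in> Theta D B" "\<theta>' \<in> regular_pairs D B" "phi \<theta>' = phi \<theta>"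
  shows "\<theta>' \<in> Theta D B"
proof -
  let ?A = "mat 1 - fst \<theta>'" and ?N = "matrix_inv (mat 1 - fst \<theta>)"
  have inv: "invertible (mat 1 - fst \<theta>)" "invertible ?A"
    using assms(1,2) by (auto simp: Theta_def regular_pairs_def RDreg_def)
  have PD: "\<And>x. x \<noteq> 0 \<Longrightarrow> x \<bullet> (snd \<theta> *v x) > 0" using assms(1) by (auto simp: Theta_def PD_def)
  have "x \<bullet> (snd \<theta>' *v x) > 0" if "x \<noteq> 0" for x
  proof -
    have "snd \<theta>' = transpose ?A ** phi \<theta> ** ?A" using phi_congruence[OF inv(2)] assms(3) by simp
    also have "\<dots> = transpose (?N ** ?A) ** snd \<theta> ** (?N ** ?A)"
      by (simp add: phi_alt matrix_transpose_mul matrix_mul_assoc)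
    finally have "x \<bullet> (snd \<theta>' *v x) = ((?N ** ?A) *v x) \<bullet> (snd \<theta> *v ((?N ** ?A) *v x))"
      by (simp only: inner_matrix_congruence)
    moreover have "(?N ** ?A) *v x \<noteq> 0"
    proof
      assume "(?N ** ?A) *v x = 0"
      then have "(matrix_inv ?A ** (mat 1 - fst \<theta>) ** ?N ** ?A) *v x = 0"
        by (metis matrix_mul_assoc matrix_vector_mul_assoc matrix_vector_mult_0_right)
      moreover have "matrix_inv ?A ** (mat 1 - fst \<theta>) ** ?N ** ?A = mat 1"
        using matrix_inv_inverse(1)[OF inv(1)] matrix_inv_inverse(2)[OF inv(2)]
        by (metis matrix_mul_assoc matrix_mul_rid)
      ultimately show False using that by simp
    qed
    ultimately show ?thesis using PD by simp
  qed
  then show ?thesis using assms(2) by (auto simp: Theta_def regular_pairs_def PD_def)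
qed

text \<open>Directions of this kind are tangent to the parameter space and annihilate the differential
  of phi: differentiate (I - Lambda)^T Sigma (I - Lambda) = Omega.\<close>
lemma phi_derivative_kernel:
  fixes D B :: "('n::finite \<times> 'n) set"
  assumes "open U" "x \<in> U"
    and inv: "\<And>y. y \<in> U \<Longrightarrow> invertible (mat 1 - fst (pair_of_coords D B y))"
    and der: "((\<lambda>y. phi (pair_of_coords D B y)) has_derivative f') (at x)"
    and sym: "transpose (snd (pair_of_coords D B x)) = snd (pair_of_coords D B x)"
    and M: "M = snd (pair_of_coords D B x) ** matrix_inv (mat 1 - fst (pair_of_coords D B x)) ** \<Delta>"
    and u: "pair_of_coords D B u = (\<Delta>, - (M + transpose M))"
  shows "f' u = 0"
proof -
  let ?P = "pair_of_coords D B"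
  let ?A = "\<lambda>y. mat 1 - fst (?P y)"
  have P: "bounded_linear ?P" using linear_pair_of_coords by (simp add: linear_linear)
  have Pder: "(?P has_derivative ?P) (at x)" by (rule bounded_linear_imp_has_derivative[OF P])
  have A: "(?A has_derivative (\<lambda>h. - fst (?P h))) (at x)"
    using has_derivative_diff[OF has_derivative_const has_derivative_fst[OF Pder], of "mat 1"] by simp
  have "linear (transpose :: real^'n^'n \<Rightarrow> real^'n^'n)"
    by (rule linearI) (auto simp: transpose_def vec_eq_iff)
  then have tr: "bounded_linear (transpose :: real^'n^'n \<Rightarrow> real^'n^'n)" by (simp add: linear_linear)
  note mult = bounded_bilinear.FDERIV[OF bounded_bilinear_matrix_mult]
  have "((\<lambda>y. transpose (?A y) ** phi (?P y) ** ?A y) has_derivative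
      (\<lambda>h. transpose (?A x) ** phi (?P x) ** (- fst (?P h)) +
        (transpose (?A x) ** f' h + transpose (- fst (?P h)) ** phi (?P x)) ** ?A x)) (at x)"
    by (rule mult[OF mult[OF bounded_linear.has_derivative[OF tr A] der] A])
  then have "((\<lambda>y. snd (?P y)) has_derivative
      (\<lambda>h. transpose (?A x) ** phi (?P x) ** (- fst (?P h)) +
        (transpose (?A x) ** f' h + transpose (- fst (?P h)) ** phi (?P x)) ** ?A x)) (at x)"
    by (rule has_derivative_transform_within_open[OF _ assms(1,2)]) (simp add: phi_congruence inv)
  from fun_cong[OF has_derivative_unique[OF has_derivative_snd[OF Pder] this], of u]
  have eq: "- (M + transpose M) = transpose (?A x) ** phi (?P x) ** (- \<Delta>) +
        (transpose (?A x) ** f' u + transpose (- \<Delta>) ** phi (?P x)) ** ?A x"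
    by (simp add: u)
  have neg: "X ** (- \<Delta>) = - (X ** \<Delta>)" "transpose (- \<Delta>) ** X = - (transpose \<Delta> ** X)"
    "(- X) ** Y = - (X ** Y)" for X Y :: "real^'n^'n"
    by (simp_all add: vec_eq_iff matrix_matrix_mult_def transpose_def sum_negf)
  have inv_x: "invertible (?A x)" by (rule inv[OF assms(2)])
  have m: "transpose (?A x) ** phi (?P x) ** \<Delta> = M"
    unfolding M by (simp add: transpose_mult_phi[OF inv_x])
  have "transpose M = transpose \<Delta> ** transpose (transpose (?A x) ** phi (?P x))"
    by (simp flip: m add: matrix_transpose_mul)
  also have "\<dots> = transpose \<Delta> ** phi (?P x) ** ?A x"
    using transpose_phi[OF sym] by (simp add: matrix_transpose_mul matrix_mul_assoc)
  finally have m': "transpose M = transpose \<Delta> ** phi (?P x) ** ?A x" .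
  have "(transpose (?A x) ** f' u - transpose \<Delta> ** phi (?P x)) ** ?A x
      = transpose (?A x) ** f' u ** ?A x - transpose M"
    unfolding m' by (rule matrix_diff_rdistrib)
  \<comment> \<open>The terms with Delta are -M and -M^T and cancel the left side, which explains
    the second component chosen for \<open>u\<close>.\<close>
  then have zero: "transpose (?A x) ** f' u ** ?A x = 0" using eq by (simp add: neg m)
  have "f' u = transpose (matrix_inv (?A x)) ** (transpose (?A x) ** f' u ** ?A x) ** matrix_inv (?A x)"
  proof -
    have "transpose (matrix_inv (?A x)) ** transpose (?A x) = mat 1"
      using matrix_inv_inverse(1)[OF inv_x] by (metis matrix_transpose_mul transpose_mat)
    moreover have "transpose (matrix_inv (?A x)) ** (transpose (?A x) ** f' u ** ?A x) ** matrix_inv (?A x)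
        = (transpose (matrix_inv (?A x)) ** transpose (?A x)) ** f' u ** (?A x ** matrix_inv (?A x))"
      by (simp add: matrix_mul_assoc)
    ultimately show ?thesis using matrix_inv_inverse(1)[OF inv_x] by simp
  qed
  then show ?thesis unfolding zero by (simp add: vec_eq_iff matrix_matrix_mult_def)
qed

lemma infinite_fibre_at_maximal_rank:
  fixes D B :: "('n::finite \<times> 'n) set"
  assumes "sym B" "HTC_infinite_to_one D B" "\<theta> \<in> Theta D B"
    and "open U" and U: "\<And>y. y \<in> U \<Longrightarrow> pair_of_coords D B y \<in> regular_pairs D B"
    and \<theta>U: "coords_of_pair \<theta> \<in> U"
    and der: "\<And>x. x \<in> U \<Longrightarrow> ((\<lambda>y. phi (pair_of_coords D B y)) has_derivative f' x) (at x)"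
    and cont: "\<And>u. continuous_on U (\<lambda>x. f' x u)"
    and rank: "\<And>x. x \<in> U \<Longrightarrow> dim (range (f' x)) \<le> dim (range (f' (coords_of_pair \<theta>)))"
    and ker: "\<And>u. pair_of_coords D B u = 0 \<Longrightarrow> f' (coords_of_pair \<theta>) u = 0"
  shows "infinite (fiber D B \<theta>)"
proof -
  let ?P = "pair_of_coords D B"
  define x0 where "x0 = coords_of_pair \<theta>"
  have \<theta>: "\<theta> \<in> regular_pairs D B" using assms(3) Theta_subset_regular_pairs by blast
  have Px0: "?P x0 = \<theta>" unfolding x0_def by (rule regular_pairs_coords[OF \<theta>])
  have lin: "linear (f' x0)" using der[OF \<theta>U] unfolding x0_def by (rule has_derivative_linear)
  obtain \<Delta> where "\<Delta> \<noteq> 0 \<and> (\<forall>v w. (v, w) \<notin> D \<longrightarrow> \<Delta> $ v $ w = 0) \<and>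
    (\<forall>y v. y \<noteq> v \<and> (y, v) \<notin> B \<longrightarrow>
       (snd \<theta> ** matrix_inv (mat 1 - fst \<theta>) ** \<Delta>) $ y $ v +
       (snd \<theta> ** matrix_inv (mat 1 - fst \<theta>) ** \<Delta>) $ v $ y = 0)"
    by (rule exE[OF HTC_infinite_to_one_imp_kernel[OF assms(1,2) \<theta>]])
  then have \<Delta>: "\<Delta> \<noteq> 0" "\<And>v w. (v, w) \<notin> D \<Longrightarrow> \<Delta> $ v $ w = 0"
    "\<And>y v. y \<noteq> v \<Longrightarrow> (y, v) \<notin> B \<Longrightarrow>
       (snd \<theta> ** matrix_inv (mat 1 - fst \<theta>) ** \<Delta>) $ y $ v +
       (snd \<theta> ** matrix_inv (mat 1 - fst \<theta>) ** \<Delta>) $ v $ y = 0"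
    by simp_all
  define M where "M = snd \<theta> ** matrix_inv (mat 1 - fst \<theta>) ** \<Delta>"
  define \<kappa> where "\<kappa> = coords_of_pair (\<Delta>, - (M + transpose M))"
  have P\<kappa>: "?P \<kappa> = (\<Delta>, - (M + transpose M))"
    unfolding \<kappa>_def
  proof (rule pair_of_coords_of_pair)
    show "fst (\<Delta>, - (M + transpose M)) $ v $ w = 0" if "(v, w) \<notin> D" for v w using \<Delta>(2) that by simp
    show "transpose (snd (\<Delta>, - (M + transpose M))) = snd (\<Delta>, - (M + transpose M))"
      by (simp add: transpose_def vec_eq_iff)
    show "snd (\<Delta>, - (M + transpose M)) $ v $ w = 0" if "v \<noteq> w" "(v, w) \<notin> B" for v w
      using \<Delta>(3)[OF that] by (simp add: M_def transpose_def)
  qed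
  have f'\<kappa>: "f' x0 \<kappa> = 0"
  proof (rule phi_derivative_kernel[OF assms(4)])
    show "x0 \<in> U" using \<theta>U by (simp add: x0_def)
    then show "((\<lambda>y. phi (?P y)) has_derivative f' x0) (at x0)" by (rule der)
    show "invertible (mat 1 - fst (?P y))" if "y \<in> U" for y
      using invertible_regular_pairs[OF U[OF that]] by (simp add: invertible_det_nz)
    show "transpose (snd (?P x0)) = snd (?P x0)" unfolding Px0 using \<theta> by (auto simp: regular_pairs_def)
    show "M = snd (?P x0) ** matrix_inv (mat 1 - fst (?P x0)) ** \<Delta>" by (simp add: M_def Px0)
    show "?P \<kappa> = (\<Delta>, - (M + transpose M))" by (rule P\<kappa>)
  qed
  obtain \<epsilon> and c :: "real \<Rightarrow> real^(('n \<times> 'n) + ('n \<times> 'n))" where \<epsilon>: "\<epsilon> > 0"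
    and c: "\<And>t. \<bar>t\<bar> < \<epsilon> \<Longrightarrow> c t \<in> U" "\<And>t. \<bar>t\<bar> < \<epsilon> \<Longrightarrow> phi (?P (c t)) = phi (?P x0)"
      "\<And>t k. \<bar>t\<bar> < \<epsilon> \<Longrightarrow> f' x0 k = 0 \<Longrightarrow> (c t - x0 - t *\<^sub>R \<kappa>) \<bullet> k = 0"
  proof -
    assume *: "\<And>\<epsilon> c. \<epsilon> > 0 \<Longrightarrow> (\<And>t. \<bar>t\<bar> < \<epsilon> \<Longrightarrow> c t \<in> U) \<Longrightarrow>
      (\<And>t. \<bar>t\<bar> < \<epsilon> \<Longrightarrow> phi (?P (c t)) = phi (?P x0)) \<Longrightarrow>
      (\<And>t k. \<bar>t\<bar> < \<epsilon> \<Longrightarrow> f' x0 k = 0 \<Longrightarrow> (c t - x0 - t *\<^sub>R \<kappa>) \<bullet> k = 0) \<Longrightarrow> thesis"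
    have "\<exists>\<epsilon>>0. \<exists>c :: real \<Rightarrow> _. \<forall>t. \<bar>t\<bar> < \<epsilon> \<longrightarrow>
        c t \<in> U \<and> phi (?P (c t)) = phi (?P x0) \<and>
        (\<forall>k. f' x0 k = 0 \<longrightarrow> (c t - x0 - t *\<^sub>R \<kappa>) \<bullet> k = 0)"
      by (rule constant_rank_fibre[OF assms(4) \<theta>U[folded x0_def] der cont rank[folded x0_def] f'\<kappa>])
    then obtain \<epsilon> c where "\<epsilon> > 0" and "\<forall>t. \<bar>t\<bar> < \<epsilon> \<longrightarrow>
        c t \<in> U \<and> phi (?P (c t)) = phi (?P x0) \<and>
        (\<forall>k. f' x0 k = 0 \<longrightarrow> (c t - x0 - t *\<^sub>R \<kappa>) \<bullet> k = 0)" by (elim exE conjE)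
    then show thesis by (intro *[of \<epsilon> c]) simp_all
  qed
  have mem: "?P (c t) \<in> fiber D B \<theta>" if "\<bar>t\<bar> < \<epsilon>" for t
    using Theta_if_phi_eq[OF assms(3) U[OF c(1)[OF that]]] c(2)[OF that] by (simp add: fiber_def Px0)
  have "inj_on (\<lambda>t. ?P (c t)) {-\<epsilon><..<\<epsilon>}"
  proof (rule inj_onI)
    fix s t assume st: "s \<in> {-\<epsilon><..<\<epsilon>}" "t \<in> {-\<epsilon><..<\<epsilon>}" "?P (c s) = ?P (c t)"
    have P0: "?P (c t - c s) = 0" using st(3) by (simp add: linear_diff[OF linear_pair_of_coords])
    \<comment> \<open>\<open>k\<close> lies in the kernel of the Jacobian, because redundant
      directions and kappa do, and it is orthogonal to that kernel as a difference of two curve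
      errors. Hence it vanishes, and c(t) - c(s) is a multiple of kappa, whose image has the nonzero
      component Delta.\<close>
    define k where "k = (c t - c s) - (t - s) *\<^sub>R \<kappa>"
    have "f' x0 (c t - c s) = 0" using ker[OF P0] by (simp add: x0_def)
    then have "f' x0 k = 0" using f'\<kappa> by (simp add: k_def linear_diff[OF lin] linear_scale[OF lin])
    then have o: "(c t - x0 - t *\<^sub>R \<kappa>) \<bullet> k = 0" "(c s - x0 - s *\<^sub>R \<kappa>) \<bullet> k = 0"
      using c(3) st by auto
    have "k = (c t - x0 - t *\<^sub>R \<kappa>) - (c s - x0 - s *\<^sub>R \<kappa>)"
      by (simp add: k_def algebra_simps)
    from arg_cong[OF this, of "\<lambda>u. u \<bullet> k"]
    have "k \<bullet> k = (c t - x0 - t *\<^sub>R \<kappa>) \<bullet> k - (c s - x0 - s *\<^sub>R \<kappa>) \<bullet> k"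
      by (simp only: inner_diff_left)
    then have "k = 0" using o by simp
    then have "c t - c s = (t - s) *\<^sub>R \<kappa>" by (simp add: k_def)
    then have "?P ((t - s) *\<^sub>R \<kappa>) = 0" using P0 by metis
    then have "(t - s) *\<^sub>R ?P \<kappa> = 0" by (simp add: linear_scale[OF linear_pair_of_coords])
    then have "(t - s) *\<^sub>R \<Delta> = 0" by (simp add: P\<kappa> prod_eq_iff)
    then show "s = t" using \<Delta>(1) by simp
  qed
  then have "infinite ((\<lambda>t. ?P (c t)) ` {-\<epsilon><..<\<epsilon>})"
    using \<epsilon> by (simp add: finite_image_iff)
  moreover have "(\<lambda>t. ?P (c t)) ` {-\<epsilon><..<\<epsilon>} \<subseteq> fiber D B \<theta>" using mem by auto
  ultimately show ?thesis using finite_subset by blast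
qed

theorem HTC_infinite_to_one_imp_generically_infinite_to_one:
  fixes D B :: "('n::finite \<times> 'n) set"
  assumes "sym B" "HTC_infinite_to_one D B"
  shows "generically_infinite_to_one D B"
proof -
  let ?P = "pair_of_coords D B"
  define U where "U = {x. det (mat 1 - fst (?P x)) \<noteq> 0}"
  have rP: "rational_matrix_on vec_nth S (\<lambda>x. fst (?P x))" "rational_matrix_on vec_nth S (\<lambda>x. snd (?P x))" for S
  proof -
    have "rational_on vec_nth S (\<lambda>x. fst (?P x) $ i $ j)" for i j
      by (cases "(i, j) \<in> D") (auto simp: pair_of_coords_def intro: rational_on_coord rational_on_const)
    moreover have "rational_on vec_nth S (\<lambda>x. snd (?P x) $ i $ j)" for i j
      by (cases "i = j \<or> (i, j) \<in> B")
         (auto simp: pair_of_coords_def intro!: rational_on_divide rational_on_add rational_on_coord rational_on_const)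
    ultimately show "rational_matrix_on vec_nth S (\<lambda>x. fst (?P x))" "rational_matrix_on vec_nth S (\<lambda>x. snd (?P x))"
      by (simp_all add: rational_matrix_on_def)
  qed
  have "continuous_on UNIV (\<lambda>x. det (mat 1 - fst (?P x)))"
    by (intro rational_on_continuous rational_on_det rational_matrix_on_diff rational_matrix_on_const rP) simp
  then have U: "open U" unfolding U_def by (intro open_Collect_neq) auto
  have PU: "?P x \<in> regular_pairs D B" if "x \<in> U" for x
    using pair_of_coords_regular[OF assms(1)] that by (simp add: U_def)
  have UP: "coords_of_pair \<theta> \<in> U" if "\<theta> \<in> regular_pairs D B" for \<theta>
    using that regular_pairs_coords[OF that] invertible_regular_pairs[OF that] by (simp add: U_def)
  define f where "f x = phi (?P x)" for x
  have "rational_matrix_on vec_nth U (\<lambda>x. phi (fst (?P x), snd (?P x)))"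
    by (intro rational_matrix_on_phi rP) (simp add: U_def)
  then have rf: "rational_matrix_on vec_nth U f" by (simp add: f_def[abs_def])
  obtain f' where der: "\<And>x. x \<in> U \<Longrightarrow> (f has_derivative f' x) (at x)"
    and rf': "\<And>u. rational_matrix_on vec_nth U (\<lambda>x. f' x u)"
    using rational_matrix_on_derivative[OF U rf] by blast
  have lin: "linear (f' x)" if "x \<in> U" for x using der[OF that] by (rule has_derivative_linear)
  have cont: "continuous_on U (\<lambda>x. f' x u)" for u
    using rf'[of u] rational_on_continuous[OF U] unfolding rational_matrix_on_def
    by (intro continuous_on_matrixI) blast
  define p where "p x = coords_of_pair (?P x)" for x
  have plin: "linear p"
    using linear_compose[OF linear_pair_of_coords linear_coords_of_pair] by (simp add: p_def[abs_def] comp_def)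
  have pU: "p x \<in> U" if "x \<in> U" for x using UP[OF PU[OF that]] by (simp add: p_def)
  \<comment> \<open>\<open>f\<close> factors through \<open>p\<close>, which discards the redundant
    directions, so its derivative does too.\<close>
  have f'p: "f' x u = f' (p x) (p u)" if x: "x \<in> U" for x u
  proof -
    have "((\<lambda>x. f (p x)) has_derivative (\<lambda>u. f' (p x) (p u))) (at x)"
    proof -
      have "(p has_derivative p) (at x)"
        using plin by (intro bounded_linear_imp_has_derivative) (simp add: linear_linear)
      then show ?thesis
        by (rule has_derivative_compose[where f = p and g = f, OF _ der[OF pU[OF x]]])
    qed
    then have "(f has_derivative (\<lambda>u. f' (p x) (p u))) (at x)"
      by (rule has_derivative_transform_within_open[OF _ U x]) (simp add: f_def p_def regular_pairs_coords PU)
    from fun_cong[OF has_derivative_unique[OF der[OF x] this]] show ?thesis .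
  qed
  have rank_p: "dim (range (f' x)) \<le> dim (range (f' (p x)))" if "x \<in> U" for x
    using f'p[OF that] by (intro dim_subset) auto
  define z where "z = coords_of_pair (0 :: real^'n^'n, mat 1 :: real^'n^'n)"
  have "z \<in> U" unfolding z_def by (rule UP[OF identity_in_regular_pairs])
  moreover have "dim (range (f' x)) < Suc (DIM(real^'n^'n))" for x
    using dim_subset_UNIV[of "range (f' x)"] by linarith
  ultimately obtain y where y: "y \<in> U" "\<And>x. x \<in> U \<Longrightarrow> dim (range (f' x)) \<le> dim (range (f' y))"
    using ex_has_greatest_nat[of "\<lambda>x. x \<in> U" z "\<lambda>x. dim (range (f' x))"] by blast
  \<comment> \<open>Passing from y to \<open>p y\<close> does not lower the rank and gives
    coordinates of an actual pair, at which the polynomial below can be tested.\<close>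
  define L where "L = f' (p y)"
  have L: "linear L" unfolding L_def by (rule lin[OF pU[OF y(1)]])
  have rank: "dim (range (f' x)) \<le> dim (range L)" if "x \<in> U" for x
    using y(2)[OF that] rank_p[OF y(1)] by (simp add: L_def)
  obtain \<pi> where \<pi>: "kernel_projection L \<pi>" using kernel_projection_exists[OF L] by blast
  \<comment> \<open>With L fixed, the determinant of \<open>G x\<close> is rational in x. Where it
    is nonzero the Jacobian has at least the rank of L, hence maximal rank.\<close>
  define G where "G x u = adjoint L (f' x u) + \<pi> u" for x u
  have Glin: "linear (G x)" if "x \<in> U" for x
    unfolding G_def using linear_compose[OF lin[OF that] adjoint_linear[OF L]] \<pi>
    by (intro linear_compose_add) (auto simp: comp_def kernel_projection_def)
  have "rational_on vec_nth U (\<lambda>x. det (matrix (G x)))"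
  proof (rule rational_on_det, unfold rational_matrix_on_def, intro allI)
    fix i j
    have "adjoint L w $ i = (\<Sum>a\<in>UNIV. \<Sum>b\<in>UNIV. w $ a $ b * L (axis i 1) $ a $ b)" for w
    proof -
      have "adjoint L w $ i = w \<bullet> L (axis i 1)"
        using adjoint_works[OF L, of "axis i 1" w] by (simp add: inner_axis' inner_commute)
      then show ?thesis by (simp add: inner_vec_def)
    qed
    then have "matrix (G x) $ i $ j = (\<Sum>a\<in>UNIV. \<Sum>b\<in>UNIV. f' x (axis j 1) $ a $ b * L (axis i 1) $ a $ b)
        + \<pi> (axis j 1) $ i" for x
      by (simp add: matrix_def G_def)
    then show "rational_on vec_nth U (\<lambda>x. matrix (G x) $ i $ j)"
      using rf' unfolding rational_matrix_on_def
      by (auto intro!: rational_on_add rational_on_sum rational_on_mult rational_on_const)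
  qed
  then obtain h where h: "polyfun h" "\<And>x. x \<in> U \<Longrightarrow> h (vec_nth x) = 0 \<longleftrightarrow> det (matrix (G x)) = 0"
    by (rule rational_on_zeros) blast
  have h_iff: "h (theta_coords \<theta>) \<noteq> 0 \<longleftrightarrow> inj (G (coords_of_pair \<theta>))" if "\<theta> \<in> regular_pairs D B" for \<theta>
  proof -
    have "vec_nth (coords_of_pair \<theta>) = theta_coords \<theta>" by (simp add: coords_of_pair_def fun_eq_iff)
    then show ?thesis using h(2)[OF UP[OF that]] det_nz_iff_inj[OF Glin[OF UP[OF that]]] by simp
  qed
  have "inj (G (p y))" unfolding G_def L_def[symmetric] by (rule rank_corrected_injective[OF L \<pi>])
  then have nz: "h (theta_coords (?P y)) \<noteq> 0" using h_iff[OF PU[OF y(1)]] by (simp add: p_def)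
  define W where "W = {\<theta> \<in> Theta D B. h (theta_coords \<theta>) = 0}"
  have "proper_algebraic_subset D B W"
    unfolding W_def by (rule proper_algebraic_subset_zeros[OF h(1) PU[OF y(1)] nz])
  moreover have "infinite (fiber D B \<theta>)" if "\<theta> \<in> Theta D B - W" for \<theta>
  proof -
    have \<theta>: "\<theta> \<in> Theta D B" "\<theta> \<in> regular_pairs D B" "h (theta_coords \<theta>) \<noteq> 0"
      using that Theta_subset_regular_pairs by (auto simp: W_def)
    have "inj (G (coords_of_pair \<theta>))" using h_iff \<theta> by blast
    then have "dim (range L) \<le> dim (range (f' (coords_of_pair \<theta>)))"
      using rank_corrected_rank[OF L \<pi> lin[OF UP[OF \<theta>(2)]]] by (simp add: G_def[abs_def])
    then have rank_\<theta>: "dim (range (f' x)) \<le> dim (range (f' (coords_of_pair \<theta>)))" if "x \<in> U" for x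
      using rank[OF that] by simp
    have ker: "f' (coords_of_pair \<theta>) u = 0" if "?P u = 0" for u
    proof -
      have "p u = 0" using that linear_0[OF linear_coords_of_pair] by (simp add: p_def)
      then show ?thesis
        using f'p[OF UP[OF \<theta>(2)], of u] linear_0[OF lin[OF pU[OF UP[OF \<theta>(2)]]]] by simp
    qed
    show ?thesis
      by (rule infinite_fibre_at_maximal_rank[OF assms \<theta>(1) U PU UP[OF \<theta>(2)]
            der[unfolded f_def[abs_def]] cont rank_\<theta> ker])
  qed
  ultimately show ?thesis unfolding generically_infinite_to_one_def by blast
qed

subsection \<open>The weak half-trek criterion\<close>

theorem mainTheorem6:
  fixes D B :: "('n::finite \<times> 'n) set"
  assumes "mixed_graph D B"
  shows "((\<exists>Y r. (\<forall>v. weak_HTC D B (Y v) v) \<and> strict_linear_order r \<and>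
                 (\<forall>v w. w \<in> Y v \<inter> htr D B v \<longrightarrow> (w, v) \<in> r))
            \<longrightarrow> rationally_identifiable D B)
       \<and> ((\<exists>Y r. (\<forall>v. weak_HTC D B (Y v) v) \<and> strict_linear_order r \<and>
                 (\<forall>v w. w \<in> Y v \<inter> htr D B v \<longrightarrow> (w, v) \<in> r))
            \<longleftrightarrow> HTC_identifiable D B)
       \<and> ((\<forall>Y :: 'n \<Rightarrow> 'n set. (\<exists>v. \<not> weak_HTC D B (Y v) v) \<or>
                 (\<exists>v w. v \<noteq> w \<and> v \<in> Y w \<and> w \<in> Y v))
            \<longrightarrow> generically_infinite_to_one D B)
       \<and> ((\<forall>Y :: 'n \<Rightarrow> 'n set. (\<exists>v. \<not> weak_HTC D B (Y v) v) \<or>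
                 (\<exists>v w. v \<noteq> w \<and> v \<in> Y w \<and> w \<in> Y v))
            \<longleftrightarrow> HTC_infinite_to_one D B)"
proof -
  have B: "sym B" using assms by (simp add: mixed_graph_def)
  show ?thesis
    unfolding weak_HTC_family_iff_HTC_identifiable[OF B]
      weak_HTC_families_iff_HTC_infinite_to_one[OF B]
    using HTC_identifiable_imp_rationally_identifiable[OF B]
      HTC_infinite_to_one_imp_generically_infinite_to_one[OF B] by simp
qed

end
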